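(* Let $n\ge 2$, and let $T\in C^1(\mathbb R_+\times\mathbb R^n\times\mathcal S^{n\times n})$ be such that the matrix $\left(-\frac{\partial T}{\partial M_{ij}}\right)$ (derivatives in the matrix argument) is positive definite on $\mathbb R_+\times\mathbb R^n\times\mathcal S^{n\times n}$. Let $u\in C^2(B_2\setminus\{0\})$ and $v\in C^2(B_2)$ satisfy $$v>0\ \text{ in } B_2,\qquad u>v\ \text{ in } B_2\setminus\{0\},\qquad \Delta u\le 0\ \text{ in } B_2\setminus\{0\},$$ $$T(u,\nabla u,\nabla^2u)\ge 0\ge T(v,\nabla v,\nabla^2v)\qquad\text{in } B_2\setminus\{0\}.$$ Assume that there are $C^1$ functions $\varphi,\xi,\psi$ near $1$ with $\varphi(1)=\xi(1)=1$, $\psi(1)=0$, $\varphi'\ge 0$, $\psi'\ge 0$, $\varphi'+\psi'>0$ near $1$, and $\varphi'\xi+\varphi\xi'\ge 0$ near $1$, such that, with $$\Phi(v,x,\lambda;y):=\varphi(\lambda)\,v(x+\xi(\lambda)y)+\psi(\lambda),$$ for some $\epsilon>0$, $$T\left(\Phi(v,0,\lambda;\cdot),\nabla\Phi(v,0,\lambda;\cdot),\nabla^2\Phi(v,0,\lambda;\cdot)\right)\le 0\quad\text{in } B_\epsilon\ \text{ for all } |\lambda-1|<\epsilon .$$ Then $$\liminf_{|x|\to 0}[u(x)-v(x)]>0 .$$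
   Context: $\mathbb R_+=(0,\infty)$; $\mathcal S^{n\times n}$ is the set of real symmetric $n\times n$ matrices; $B_a\subset\mathbb R^n$ is the ball of radius $a$ centered at the origin; derivatives of $\Phi(v,0,\lambda;\cdot)$ are taken in the variable $y$. *)

theory Defs
  imports "HOL-Analysis.Analysis"
begin

text \<open>
  Continuous differentiability on \<open>S\<close>.  The derivative is taken within \<open>S\<close>, so that the notion also
  applies to a relatively open subset of a proper linear subspace (needed for functions of symmetric
  matrices); for open \<open>S\<close> it is the usual class $C^1(S)$.
\<close>

definition C1_on :: "('a::real_normed_vector \<Rightarrow> real) \<Rightarrow> 'a set \<Rightarrow> bool" where
  "C1_on f S \<longleftrightarrow>
     (\<exists>f' :: 'a \<Rightarrow> 'a \<Rightarrow>\<^sub>L real. continuous_on S f' \<and>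
        (\<forall>x\<in>S. (f has_derivative blinfun_apply (f' x)) (at x within S)))"

definition grad :: "(real^'n \<Rightarrow> real) \<Rightarrow> real^'n \<Rightarrow> real^'n" where
  "grad f x = (\<chi> i. frechet_derivative f (at x) (axis i 1))"

definition C2_on :: "(real^'n \<Rightarrow> real) \<Rightarrow> (real^'n) set \<Rightarrow> bool" where
  "C2_on f S \<longleftrightarrow> C1_on f S \<and> (\<forall>i. C1_on (\<lambda>x. grad f x $ i) S)"

definition hessian :: "(real^'n \<Rightarrow> real) \<Rightarrow> real^'n \<Rightarrow> real^'n^'n" where
  "hessian f x = (\<chi> i j. grad (\<lambda>y. grad f y $ i) x $ j)"

definition laplacian :: "(real^'n \<Rightarrow> real) \<Rightarrow> real^'n \<Rightarrow> real" where
  "laplacian f x = (\<Sum>i\<in>UNIV. hessian f x $ i $ i)"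

definition symmetric_matrices :: "(real^'n^'n) set" where
  "symmetric_matrices = {M. transpose M = M}"

definition positive_definite :: "real^'n^'n \<Rightarrow> bool" where
  "positive_definite A \<longleftrightarrow> transpose A = A \<and> (\<forall>x. x \<noteq> 0 \<longrightarrow> x \<bullet> (A *v x) > 0)"

text \<open>
  The matrix of derivatives $\partial F/\partial M_{ij}$ of a function on symmetric matrices, with the
  usual convention that it is the symmetric matrix \<open>G\<close> for which the differential of \<open>F\<close> at \<open>M\<close>,
  as a linear form on symmetric matrices, is $N \mapsto \sum_{i,j} G_{ij} N_{ij}$
  (which is the inner product \<open>G \<bullet> N\<close> of the type of matrices).
\<close>

definition matrix_partials :: "(real^'n^'n \<Rightarrow> real) \<Rightarrow> real^'n^'n \<Rightarrow> real^'n^'n" where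
  "matrix_partials F M =
     (THE G. G \<in> symmetric_matrices \<and>
             (F has_derivative (\<lambda>N. G \<bullet> N)) (at M within symmetric_matrices))"

definition Phi :: "(real \<Rightarrow> real) \<Rightarrow> (real \<Rightarrow> real) \<Rightarrow> (real \<Rightarrow> real) \<Rightarrow>
    (real^'n \<Rightarrow> real) \<Rightarrow> real^'n \<Rightarrow> real \<Rightarrow> real^'n \<Rightarrow> real" where
  "Phi \<phi> \<xi> \<psi> v x l y = \<phi> l * v (x + \<xi> l *\<^sub>R y) + \<psi> l"

end

theory Submission
  imports Defs
begin

text \<open>
  Suppose that the limit inferior of \<open>u - v\<close> at the origin is \<open>0\<close>, so that \<open>u\<close> comes arbitrarily close to
  \<open>v 0\<close> there. Then \<open>u\<close>, which is superharmonic off the origin and bounded below, is so tightly pinned at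
  the origin that every minorant with value \<open>v 0\<close> there must have the same gradient as \<open>v\<close>.
  Exhibiting many such subsolutions determines \<open>v\<close> so far that \<open>v\<close> turns out to be subharmonic, and
  this contradicts the minimum principle for \<open>u - v\<close>.

  \<^item> Pinning (\<open>two_touching_minorants\<close>): two minorants of \<open>u\<close> with equal value and different
    gradients at the origin put a wedge under \<open>u\<close>. A harmonic quadratic polynomial that lies below the
    wedge on a small sphere exceeds the common value at the centre, and it stays below \<open>u\<close> because a
    point is negligible for superharmonic functions bounded below in dimension at least two
    (\<open>punctured_ball_minimum_principle\<close>, by comparison with the logarithm).

  \<^item> Many subsolutions: the operator does not depend on the space variable, so translating the argument
    of \<open>\<Phi>(v,0,\<lambda>)\<close> shows that \<open>\<Phi>(v,x,\<lambda>)\<close> is a subsolution for every small \<open>x\<close>. Its value at the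
    origin increases with \<open>\<lambda>\<close>, and \<open>\<lambda>(x)\<close> denotes the parameter at which that value equals \<open>v 0\<close>.
    Starting from a slightly smaller parameter, where \<open>\<Phi>(v,x,\<lambda>)\<close> lies below \<open>v\<close> and hence below \<open>u\<close>,
    the parameter can be raised up to \<open>\<lambda>(x)\<close> with \<open>\<Phi>(v,x,\<lambda>)\<close> staying below \<open>u\<close> (\<open>sliding_method\<close>): a
    first contact would be off the origin and inside the ball, which the strong comparison principle
    for the nonlinear operator excludes (\<open>strong_comparison_principle\<close>).

  \<^item> Consequence: comparing gradients of \<open>\<Phi>(v,x,\<lambda>(x))\<close> and \<open>v\<close> at the origin gives
    \<open>\<phi>(\<lambda>(x)) \<xi>(\<lambda>(x)) \<nabla>v(x) = \<nabla>v(0)\<close>, so the gradient is a positive multiple of a fixed vector. Where \<open>v\<close> is larger,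
    \<open>\<lambda>(x)\<close> is smaller, hence so is \<open>\<phi> \<xi>\<close>, whose derivative is nonnegative, and therefore the gradient
    of \<open>v\<close> is longer. Thus the gradient of \<open>v\<close> is monotone near the origin, which makes \<open>v\<close> convex and
    \<open>u - v\<close> superharmonic and positive; by the minimum principle it is bounded away from \<open>0\<close>.
\<close>

section \<open>Second-order jets\<close>

text \<open>
  The function \<open>g\<close> is the gradient of \<open>f\<close> on a whole neighbourhood of \<open>x\<close>, so that \<open>H\<close> is a Hessian.
  Carrying \<open>g\<close> and \<open>H\<close> as arguments lets the jets of barriers be assembled from those of their summands.
\<close>

definition has_2jet ::
    "(real^'n \<Rightarrow> real) \<Rightarrow> (real^'n \<Rightarrow> real^'n) \<Rightarrow> real^'n^'n \<Rightarrow> real^'n \<Rightarrow> bool" where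
  "has_2jet f g H x \<longleftrightarrow>
     (\<forall>\<^sub>F y in nhds x. (f has_derivative (\<lambda>h. g y \<bullet> h)) (at y)) \<and>
     (g has_derivative (\<lambda>h. H *v h)) (at x)"

lemma has_2jetI:
  assumes "open S" "x \<in> S" "\<And>y. y \<in> S \<Longrightarrow> (f has_derivative (\<lambda>h. g y \<bullet> h)) (at y)"
    and "(g has_derivative (\<lambda>h. H *v h)) (at x)"
  shows "has_2jet f g H x"
  using assms unfolding has_2jet_def eventually_nhds by blast

lemma has_2jet_gradient:
  "has_2jet f g H x \<Longrightarrow> (f has_derivative (\<lambda>h. g x \<bullet> h)) (at x)"
  unfolding has_2jet_def using eventually_nhds_x_imp_x by fastforce

lemma has_2jet_add:
  assumes "has_2jet f g H x" "has_2jet f' g' H' x"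
  shows "has_2jet (\<lambda>y. f y + f' y) (\<lambda>y. g y + g' y) (H + H') x"
proof -
  have "\<forall>\<^sub>F y in nhds x. (f has_derivative (\<lambda>h. g y \<bullet> h)) (at y) \<and> (f' has_derivative (\<lambda>h. g' y \<bullet> h)) (at y)"
    using assms unfolding has_2jet_def by (simp add: eventually_conj)
  then have "\<forall>\<^sub>F y in nhds x. ((\<lambda>y. f y + f' y) has_derivative (\<lambda>h. (g y + g' y) \<bullet> h)) (at y)"
    by eventually_elim (auto simp: inner_add_left intro!: derivative_eq_intros)
  then show ?thesis
    using assms unfolding has_2jet_def
    by (auto simp: matrix_vector_mult_add_rdistrib intro!: derivative_eq_intros)
qed

lemma scaleR_matrix_vector: "(c *\<^sub>R (A::real^'n^'m)) *v x = c *\<^sub>R (A *v x)"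
  by (simp add: matrix_vector_mult_def vec_eq_iff sum_distrib_left mult.assoc)

lemma has_2jet_scale:
  assumes "has_2jet f g H x"
  shows "has_2jet (\<lambda>y. c * f y) (\<lambda>y. c *\<^sub>R g y) (c *\<^sub>R H) x"
  using assms unfolding has_2jet_def
  by (auto elim!: eventually_mono simp: scaleR_matrix_vector intro!: derivative_eq_intros)

lemma has_2jet_minus:
  assumes "has_2jet f g H x" "has_2jet f' g' H' x"
  shows "has_2jet (\<lambda>y. f y - f' y) (\<lambda>y. g y - g' y) (H - H') x"
  using has_2jet_add[OF assms(1) has_2jet_scale[OF assms(2), of "-1"]] by simp

lemma has_2jet_affine: "has_2jet (\<lambda>y. c + p \<bullet> y) (\<lambda>y. p) 0 x"
  unfolding has_2jet_def by (auto intro!: derivative_eq_intros always_eventually)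

lemma has_2jet_comp_affine:
  assumes "has_2jet f g H (a + c *\<^sub>R x)"
  shows "has_2jet (\<lambda>y. k * f (a + c *\<^sub>R y) + m) (\<lambda>y. (k * c) *\<^sub>R g (a + c *\<^sub>R y)) ((k * c\<^sup>2) *\<^sub>R H) x"
proof -
  let ?A = "\<lambda>y. a + c *\<^sub>R y"
  have "isCont ?A x" by (intro continuous_intros)
  then have "filterlim ?A (nhds (?A x)) (nhds x)"
    unfolding isCont_def by (rule tendsto_at_iff_tendsto_nhds[of ?A, THEN iffD1])
  with assms have ev: "\<forall>\<^sub>F y in nhds x. (f has_derivative (\<lambda>h. g (?A y) \<bullet> h)) (at (?A y))"
    unfolding has_2jet_def filterlim_iff by blast
  have A: "(?A has_derivative (\<lambda>h. c *\<^sub>R h)) (at y)" for y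
    by (auto intro!: derivative_eq_intros)
  show ?thesis unfolding has_2jet_def
  proof
    show "\<forall>\<^sub>F y in nhds x. ((\<lambda>y. k * f (?A y) + m) has_derivative
        (\<lambda>h. (k * c) *\<^sub>R g (?A y) \<bullet> h)) (at y)"
      using ev
    proof eventually_elim
      case (elim y)
      show ?case
        by (rule derivative_eq_intros has_derivative_compose[OF A elim] refl)+ (auto simp: fun_eq_iff)
    qed
    have g: "(g has_derivative (\<lambda>h. H *v h)) (at (?A x))"
      using assms unfolding has_2jet_def by auto
    show "((\<lambda>y. (k * c) *\<^sub>R g (?A y)) has_derivative (\<lambda>h. ((k * c\<^sup>2) *\<^sub>R H) *v h)) (at x)"
      by (rule derivative_eq_intros has_derivative_compose[OF A g] refl)+
        (auto simp: fun_eq_iff scaleR_matrix_vector matrix_vector_mult_scaleR power2_eq_square)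
  qed
qed

definition outer :: "real^'n \<Rightarrow> real^'n^'n" where
  "outer x = (\<chi> i j. x $ i * x $ j)"

lemma outer_mult_vec: "outer x *v h = (x \<bullet> h) *\<^sub>R x"
  by (simp add: outer_def matrix_vector_mult_def vec_eq_iff inner_vec_def sum_distrib_left mult_ac)

lemma trace_outer: "trace (outer x) = x \<bullet> x"
  by (simp add: outer_def trace_def inner_vec_def)

lemma trace_scaleR: "trace (c *\<^sub>R (A::real^'n^'n)) = c * trace A"
  by (simp add: trace_def sum_distrib_left)

text \<open>
  The barriers below are built from a logarithm and a Gaussian of the distance to a point. Written as
  functions of the squared distance they are smooth functions of a quadratic polynomial, and the
  rank-one summand of the Hessian carries the second derivative of the profile.
\<close>

lemma has_2jet_radial:
  fixes z x :: "real^'n"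
  assumes S: "open S" "(x - z) \<bullet> (x - z) \<in> S"
    and F: "\<And>s. s \<in> S \<Longrightarrow> (F has_real_derivative F' s) (at s)"
    and F': "(F' has_real_derivative F'') (at ((x - z) \<bullet> (x - z)))"
  shows "has_2jet (\<lambda>y. F ((y - z) \<bullet> (y - z))) (\<lambda>y. (2 * F' ((y - z) \<bullet> (y - z))) *\<^sub>R (y - z))
           ((2 * F' ((x - z) \<bullet> (x - z))) *\<^sub>R mat 1 + (4 * F'') *\<^sub>R outer (x - z)) x"
proof -
  let ?N = "\<lambda>y. (y - z) \<bullet> (y - z)"
  have N: "(?N has_derivative (\<lambda>h. 2 * ((y - z) \<bullet> h))) (at y)" for y
    by (auto intro!: derivative_eq_intros simp: fun_eq_iff inner_commute)
  have "open (?N -` S)"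
    by (rule open_vimage[OF S(1)]) (auto intro!: continuous_intros)
  moreover have "((\<lambda>y. F (?N y)) has_derivative (\<lambda>h. (2 * F' (?N y)) *\<^sub>R (y - z) \<bullet> h)) (at y)"
    if "y \<in> ?N -` S" for y
  proof -
    have "(F has_derivative (\<lambda>t. F' (?N y) * t)) (at (?N y))"
      using F[of "?N y"] that by (auto simp: has_field_derivative_def)
    from has_derivative_compose[OF N this] show ?thesis
      by (simp add: mult_ac)
  qed
  moreover have "((\<lambda>y. (2 * F' (?N y)) *\<^sub>R (y - z)) has_derivative
      (\<lambda>h. ((2 * F' (?N x)) *\<^sub>R mat 1 + (4 * F'') *\<^sub>R outer (x - z)) *v h)) (at x)"
  proof -
    have "(F' has_derivative (\<lambda>t. F'' * t)) (at (?N x))"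
      using F' by (auto simp: has_field_derivative_def)
    note * = has_derivative_compose[OF N this]
    show ?thesis
      by (rule derivative_eq_intros * refl)+
         (auto simp: fun_eq_iff matrix_vector_mult_add_rdistrib scaleR_matrix_vector outer_mult_vec algebra_simps)
  qed
  ultimately show ?thesis using S by (intro has_2jetI[of "?N -` S"]) auto
qed

lemma has_2jet_square:
  fixes e x :: "real^'n"
  shows "has_2jet (\<lambda>y. (e \<bullet> y)\<^sup>2) (\<lambda>y. (2 * (e \<bullet> y)) *\<^sub>R e) (2 *\<^sub>R outer e) x"
  unfolding has_2jet_def
  by (auto intro!: derivative_eq_intros always_eventually
      simp: fun_eq_iff scaleR_matrix_vector outer_mult_vec)

lemma grad_eqI: "(f has_derivative (\<lambda>h. g \<bullet> h)) (at x) \<Longrightarrow> grad f x = g"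
  unfolding grad_def by (simp add: frechet_derivative_at[symmetric] vec_eq_iff inner_axis)

lemma has_2jet_grad_hessian:
  assumes "has_2jet f g H x"
  shows "grad f x = g x" "hessian f x = H"
proof -
  show "grad f x = g x" by (rule grad_eqI[OF has_2jet_gradient[OF assms]])
  obtain S where S: "open S" "x \<in> S" "\<And>y. y \<in> S \<Longrightarrow> (f has_derivative (\<lambda>h. g y \<bullet> h)) (at y)"
    using assms unfolding has_2jet_def eventually_nhds by blast
  have "grad (\<lambda>y. grad f y $ i) x = H $ i" for i
  proof (rule grad_eqI, rule has_derivative_transform_within_open[OF _ S(1,2)])
    have "(g has_derivative (\<lambda>h. H *v h)) (at x)" using assms by (simp add: has_2jet_def)
    from bounded_linear.has_derivative[OF bounded_linear_vec_nth[of i] this]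
    show "((\<lambda>y. g y $ i) has_derivative (\<lambda>h. H $ i \<bullet> h)) (at x)"
      by (simp add: matrix_vector_mult_def inner_vec_def)
    show "g y $ i = grad f y $ i" if "y \<in> S" for y using grad_eqI[OF S(3)[OF that]] by simp
  qed
  then show "hessian f x = H" by (simp add: hessian_def vec_eq_iff)
qed

text \<open>
  The derivatives provided by \<open>C1_on\<close> are taken within \<open>S\<close>; on an open set they are full derivatives and
  hence are represented by the gradient, which inherits their continuity.
\<close>

lemma C1_onD:
  fixes f :: "real^'n \<Rightarrow> real"
  assumes "open S" "C1_on f S"
  shows "continuous_on S (grad f)"
    and "\<And>x. x \<in> S \<Longrightarrow> (f has_derivative (\<lambda>h. grad f x \<bullet> h)) (at x)"
proof -
  obtain f' where f': "continuous_on S f'" "\<And>x. x \<in> S \<Longrightarrow> (f has_derivative blinfun_apply (f' x)) (at x within S)"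
    using assms(2) unfolding C1_on_def by auto
  have D: "(f has_derivative blinfun_apply (f' x)) (at x)" if "x \<in> S" for x
    using f'(2)[OF that] at_within_open[OF that assms(1)] by simp
  have g: "grad f x = (\<chi> i. blinfun_apply (f' x) (axis i 1))" if "x \<in> S" for x
    unfolding grad_def using frechet_derivative_at[OF D[OF that]] by simp
  show "(f has_derivative (\<lambda>h. grad f x \<bullet> h)) (at x)" if "x \<in> S" for x
  proof -
    have "blinfun_apply (f' x) h = grad f x \<bullet> h" for h
    proof -
      interpret bounded_linear "blinfun_apply (f' x)" by (rule blinfun.bounded_linear_right)
      have "blinfun_apply (f' x) h = blinfun_apply (f' x) (\<Sum>i\<in>UNIV. (h $ i) *\<^sub>R axis i 1)"
        using basis_expansion[of h] by (simp add: scalar_mult_eq_scaleR)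
      also have "\<dots> = (\<Sum>i\<in>UNIV. h $ i * blinfun_apply (f' x) (axis i 1))"
        by (simp add: sum scaleR)
      finally show ?thesis by (simp add: g[OF that] inner_vec_def mult.commute)
    qed
    then have "blinfun_apply (f' x) = (\<lambda>h. grad f x \<bullet> h)" by blast
    with D[OF that] show ?thesis by metis
  qed
  have "continuous_on S (\<lambda>x. \<chi> i. blinfun_apply (f' x) (axis i 1))"
    by (intro continuous_on_vec_lambda continuous_intros f')
  then show "continuous_on S (grad f)" using g by (simp cong: continuous_on_cong)
qed

lemma C2_onD:
  assumes "open S" "C2_on f S"
  shows "continuous_on S f" "continuous_on S (grad f)" "continuous_on S (hessian f)"
    and "\<And>x. x \<in> S \<Longrightarrow> has_2jet f (grad f) (hessian f x) x"
proof -
  have C1: "C1_on f S" "\<And>i. C1_on (\<lambda>x. grad f x $ i) S" using assms by (auto simp: C2_on_def)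
  note f = C1_onD[OF assms(1) C1(1)] and g = C1_onD[OF assms(1) C1(2)]
  show "continuous_on S f"
    using f(2) has_derivative_continuous continuous_at_imp_continuous_on by blast
  show "continuous_on S (grad f)" by (rule f)
  have "continuous_on S (\<lambda>x. \<chi> i j. grad (\<lambda>y. grad f y $ i) x $ j)"
    by (intro continuous_on_vec_lambda continuous_intros g(1))
  then show "continuous_on S (hessian f)" unfolding hessian_def[abs_def] .
  fix x assume x: "x \<in> S"
  have "((\<lambda>y. grad f y $ i) has_derivative (\<lambda>h. hessian f x $ i \<bullet> h)) (at x)" for i
    using g(2)[OF x, of i] by (simp add: hessian_def)
  then have "((\<lambda>y. \<Sum>i\<in>UNIV. (grad f y $ i) *\<^sub>R axis i (1::real)) has_derivative
      (\<lambda>h. \<Sum>i\<in>UNIV. (hessian f x $ i \<bullet> h) *\<^sub>R axis i (1::real))) (at x)"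
    by (intro has_derivative_sum has_derivative_scaleR_left)
  moreover have expand: "(\<Sum>i\<in>UNIV. (y $ i) *\<^sub>R axis i 1) = y" for y :: "real^'n"
    using basis_expansion[of y] by (simp add: scalar_mult_eq_scaleR)
  moreover have "(\<Sum>i\<in>UNIV. (hessian f x $ i \<bullet> h) *\<^sub>R axis i 1) = hessian f x *v h" for h
    using expand[of "hessian f x *v h"] by (simp add: matrix_vector_mult_def inner_vec_def)
  ultimately have "(grad f has_derivative (\<lambda>h. hessian f x *v h)) (at x)"
    by (simp only: expand)
  then show "has_2jet f (grad f) (hessian f x) x"
    using f(2) by (intro has_2jetI[OF assms(1) x]) auto
qed

lemma has_2jet_second_derivative_along_line:
  assumes "has_2jet f g H x"
  shows "((\<lambda>t. g (x + t *\<^sub>R d) \<bullet> d) has_real_derivative (d \<bullet> (H *v d))) (at 0)"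
proof -
  have L: "((\<lambda>t. x + t *\<^sub>R d) has_derivative (\<lambda>t. t *\<^sub>R d)) (at 0)"
    by (auto intro!: derivative_eq_intros)
  have "((\<lambda>t. g (x + t *\<^sub>R d)) has_derivative (\<lambda>t. H *v (t *\<^sub>R d))) (at 0)"
    by (rule has_derivative_compose[OF L, of g]) (use assms in \<open>simp add: has_2jet_def\<close>)
  from has_derivative_inner_left[OF this, of d] show ?thesis
    unfolding has_field_derivative_def
    by (rule has_derivative_eq_rhs) (simp add: fun_eq_iff matrix_vector_mult_scaleR inner_commute)
qed

lemma trace_nonnegI:
  fixes H :: "real^'n^'n"
  assumes "\<And>d. d \<bullet> (H *v d) \<ge> 0"
  shows "trace H \<ge> 0"
proof -
  have "trace H = (\<Sum>i\<in>UNIV. axis i 1 \<bullet> (H *v axis i 1))"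
    by (simp add: trace_def inner_axis' matrix_vector_mult_basis column_def)
  then show ?thesis using assms by (simp add: sum_nonneg)
qed

text \<open>
  First and second order conditions at a minimum. The gradient is differentiable only at \<open>x\<close>, so the
  second condition is obtained from the mean value theorem: if the form were negative in direction \<open>d\<close>,
  the slope along \<open>d\<close> would be negative on a short segment starting at \<open>x\<close>, and \<open>f\<close> would decrease there.
\<close>

lemma has_2jet_local_min:
  assumes J: "has_2jet f g H x" and S: "open S" "x \<in> S" "\<And>y. y \<in> S \<Longrightarrow> f x \<le> f y"
  shows "g x = 0" "d \<bullet> (H *v d) \<ge> 0"
proof -
  have "(\<lambda>h. g x \<bullet> h) = (\<lambda>h. 0)"
    using differential_zero_maxmin[OF S(2,1) has_2jet_gradient[OF J]] S(3) by blast
  then have "g x \<bullet> g x = 0" by meson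
  then show g0: "g x = 0" by simp
  show "d \<bullet> (H *v d) \<ge> 0"
  proof (rule ccontr)
    assume neg: "\<not> ?thesis"
    have L: "((\<lambda>t. x + t *\<^sub>R d) has_derivative (\<lambda>t. t *\<^sub>R d)) (at t)" for t
      by (auto intro!: derivative_eq_intros)
    from DERIV_neg_dec_right[OF has_2jet_second_derivative_along_line[OF J], of d] neg obtain d1 where d1: "d1 > 0"
      "\<And>h. h > 0 \<Longrightarrow> h < d1 \<Longrightarrow> g (x + h *\<^sub>R d) \<bullet> d < 0"
      by (auto simp: g0)
    obtain R where R: "open R" "x \<in> R" "\<And>y. y \<in> R \<Longrightarrow> (f has_derivative (\<lambda>h. g y \<bullet> h)) (at y)"
      using J unfolding has_2jet_def eventually_nhds by blast
    have "open ((\<lambda>t. x + t *\<^sub>R d) -` (R \<inter> S))"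
      using R S by (intro open_vimage) (auto intro!: continuous_intros)
    moreover have "0 \<in> (\<lambda>t. x + t *\<^sub>R d) -` (R \<inter> S)" using R S by auto
    ultimately obtain e where "e > 0" "ball 0 e \<subseteq> (\<lambda>t. x + t *\<^sub>R d) -` (R \<inter> S)"
      unfolding open_contains_ball by blast
    then have e: "e > 0" "\<And>t. \<bar>t\<bar> < e \<Longrightarrow> x + t *\<^sub>R d \<in> R \<inter> S"
      by (auto simp: subset_iff)
    define t where "t = min e d1 / 2"
    have t: "0 < t" "t < e" "t < d1" using e(1) d1(1) by (auto simp: t_def)
    have D: "((\<lambda>t. f (x + t *\<^sub>R d)) has_real_derivative (g (x + s *\<^sub>R d) \<bullet> d)) (at s)" if "0 \<le> s" "s \<le> t" for s
    proof -
      have "x + s *\<^sub>R d \<in> R" using e(2)[of s] that t by auto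
      from has_derivative_compose[OF L R(3)[OF this]] show ?thesis
        unfolding has_field_derivative_def by (rule has_derivative_eq_rhs) (simp add: fun_eq_iff)
    qed
    obtain s where s: "0 < s" "s < t" "f (x + t *\<^sub>R d) - f (x + 0 *\<^sub>R d) = (t - 0) * (g (x + s *\<^sub>R d) \<bullet> d)"
      using MVT2[of 0 t "\<lambda>t. f (x + t *\<^sub>R d)" "\<lambda>s. g (x + s *\<^sub>R d) \<bullet> d"] D t by auto
    have "f (x + t *\<^sub>R d) < f x"
      using s(3) mult_pos_neg[OF t(1) d1(2)[OF s(1)]] s(2) t(3) by simp
    then show False using S(3)[of "x + t *\<^sub>R d"] e(2)[of t] t by auto
  qed
qed

section \<open>Symmetry of second derivatives and rank-one elimination\<close>

text \<open>
  The mean value theorem, applied along \<open>h\<close> to the increment of \<open>f\<close> in direction \<open>k\<close>, turns the mixed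
  difference into an increment of the gradient, which is given by \<open>H\<close> up to a small error. The mixed
  difference is symmetric in \<open>h\<close> and \<open>k\<close>, so the symmetry of \<open>H\<close> follows.
\<close>

lemma has_2jet_mixed_difference:
  assumes J: "has_2jet f g H x" and "e > 0"
  shows "\<exists>d>0. \<forall>t. 0 < t \<and> t < d \<longrightarrow>
    \<bar>f (x + t *\<^sub>R h + t *\<^sub>R k) - f (x + t *\<^sub>R h) - f (x + t *\<^sub>R k) + f x - t\<^sup>2 * ((H *v k) \<bullet> h)\<bar>
      \<le> e * t\<^sup>2"
proof -
  have gH: "(g has_derivative (\<lambda>h. H *v h)) (at x)" using J by (simp add: has_2jet_def)
  define N where "N = (2 * (norm h + norm k) + 1) * (norm h + 1)"
  have N: "N > 0" by (simp add: N_def add_nonneg_pos)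
  obtain R where R: "open R" "x \<in> R" "\<And>y. y \<in> R \<Longrightarrow> (f has_derivative (\<lambda>h. g y \<bullet> h)) (at y)"
    using J unfolding has_2jet_def eventually_nhds by blast
  obtain d1 where d1: "d1 > 0" "ball x d1 \<subseteq> R" using R open_contains_ball by blast
  obtain d2 where d2: "d2 > 0" "\<And>y. norm (y - x) < d2 \<Longrightarrow>
      norm (g y - g x - H *v (y - x)) \<le> e / N * norm (y - x)"
    using gH \<open>e > 0\<close> N unfolding has_derivative_at_alt by (metis divide_pos_pos)
  define d where "d = min d1 d2 / (norm h + norm k + 1)"
  have pos: "norm h + norm k + 1 > 0" by (simp add: add_nonneg_pos)
  have "d > 0" unfolding d_def using d1 d2 pos by simp
  moreover have "\<bar>f (x + t *\<^sub>R h + t *\<^sub>R k) - f (x + t *\<^sub>R h) - f (x + t *\<^sub>R k) + f x - t\<^sup>2 * ((H *v k) \<bullet> h)\<bar>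
      \<le> e * t\<^sup>2" if t: "0 < t" "t < d" for t
  proof -
    have small: "norm (s *\<^sub>R h + q *\<^sub>R k) < min d1 d2"
        "norm (s *\<^sub>R h + q *\<^sub>R k) \<le> t * (norm h + norm k)"
      if "0 \<le> s" "s \<le> t" "0 \<le> q" "q \<le> t" for s q
    proof -
      have "norm (s *\<^sub>R h + q *\<^sub>R k) \<le> s * norm h + q * norm k"
        using norm_triangle_ineq[of "s *\<^sub>R h" "q *\<^sub>R k"] that by simp
      also have "\<dots> \<le> t * norm h + t * norm k" using that by (intro add_mono mult_right_mono) auto
      finally show *: "norm (s *\<^sub>R h + q *\<^sub>R k) \<le> t * (norm h + norm k)" by (simp add: algebra_simps)
      also have "\<dots> < t * (norm h + norm k + 1)" using t by simp
      also have "\<dots> < min d1 d2" using t(2) pos unfolding d_def by (simp add: pos_less_divide_eq)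
      finally show "norm (s *\<^sub>R h + q *\<^sub>R k) < min d1 d2" .
    qed
    define F where "F = (\<lambda>s. f (x + s *\<^sub>R h + t *\<^sub>R k) - f (x + s *\<^sub>R h))"
    define F' where "F' = (\<lambda>s. (g (x + s *\<^sub>R h + t *\<^sub>R k) - g (x + s *\<^sub>R h)) \<bullet> h)"
    have D: "(F has_real_derivative F' s) (at s)" if s: "0 \<le> s" "s \<le> t" for s
    proof -
      have in1: "x + s *\<^sub>R h + t *\<^sub>R k \<in> R" "x + s *\<^sub>R h \<in> R"
        using small[of s t] small[of s 0] s t d1(2) by (auto simp: subset_iff dist_norm norm_minus_commute add.assoc)
      have L: "((\<lambda>s. x + s *\<^sub>R h + t *\<^sub>R k) has_derivative (\<lambda>s. s *\<^sub>R h)) (at s)"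
        "((\<lambda>s. x + s *\<^sub>R h) has_derivative (\<lambda>s. s *\<^sub>R h)) (at s)"
        by (auto intro!: derivative_eq_intros)
      have "(F has_derivative (\<lambda>q. g (x + s *\<^sub>R h + t *\<^sub>R k) \<bullet> (q *\<^sub>R h) - g (x + s *\<^sub>R h) \<bullet> (q *\<^sub>R h))) (at s)"
        unfolding F_def
        by (intro has_derivative_diff has_derivative_compose[OF L(1) R(3)[OF in1(1)]]
            has_derivative_compose[OF L(2) R(3)[OF in1(2)]])
      then show ?thesis unfolding has_field_derivative_def
        by (rule has_derivative_eq_rhs) (simp add: F'_def fun_eq_iff algebra_simps)
    qed
    obtain s where s: "0 < s" "s < t" "F t - F 0 = (t - 0) * F' s"
      using MVT2[of 0 t F F'] D t by auto
    define E where "E = (\<lambda>y. g y - g x - H *v (y - x))"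
    define y1 y2 where "y1 = x + s *\<^sub>R h + t *\<^sub>R k" and "y2 = x + s *\<^sub>R h"
    have E: "norm (E y) \<le> e / N * (t * (norm h + norm k))" if "y = y1 \<or> y = y2" for y
    proof -
      have *: "norm (y - x) < d2 \<and> norm (y - x) \<le> t * (norm h + norm k)"
        using that small[of s t] small[of s 0] s t by (auto simp: y1_def y2_def add.assoc)
      have "norm (E y) \<le> e / N * norm (y - x)" unfolding E_def using * d2(2) by blast
      also have "\<dots> \<le> e / N * (t * (norm h + norm k))"
        using * \<open>e > 0\<close> N by (intro mult_left_mono) auto
      finally show ?thesis .
    qed
    have "g y1 - g y2 = E y1 - E y2 + t *\<^sub>R (H *v k)"
    proof -
      have "y1 - x = (y2 - x) + t *\<^sub>R k" by (simp add: y1_def y2_def)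
      then have "H *v (y1 - x) = H *v (y2 - x) + t *\<^sub>R (H *v k)"
        by (simp only: matrix_vector_right_distrib matrix_vector_mult_scaleR)
      then show ?thesis by (simp add: E_def)
    qed
    moreover have "F' s = (g y1 - g y2) \<bullet> h" by (simp add: F'_def y1_def y2_def)
    ultimately have "F' s = (E y1 - E y2) \<bullet> h + t * ((H *v k) \<bullet> h)"
      by (simp add: inner_add_left)
    then have "F t - F 0 - t\<^sup>2 * ((H *v k) \<bullet> h) = t * ((E y1 - E y2) \<bullet> h)"
      using s(3) by (simp add: power2_eq_square distrib_left)
    moreover have "\<bar>(E y1 - E y2) \<bullet> h\<bar> \<le> e * t"
    proof -
      have "\<bar>(E y1 - E y2) \<bullet> h\<bar> \<le> norm (E y1 - E y2) * norm h" by (rule Cauchy_Schwarz_ineq2)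
      also have "\<dots> \<le> (norm (E y1) + norm (E y2)) * norm h"
        by (intro mult_right_mono norm_triangle_ineq4) auto
      also have "\<dots> \<le> (2 * (e / N * (t * (norm h + norm k)))) * norm h"
      proof (rule mult_right_mono)
        show "norm (E y1) + norm (E y2) \<le> 2 * (e / N * (t * (norm h + norm k)))"
          using add_mono[OF E[of y1] E[of y2]] by (simp only: mult_2 simp_thms)
      qed simp
      also have "\<dots> = e * t / N * (2 * (norm h + norm k) * norm h)" by simp
      also have "\<dots> \<le> e * t / N * N"
        using \<open>e > 0\<close> t N unfolding N_def by (intro mult_left_mono mult_mono) auto
      finally show ?thesis using N by simp
    qed
    ultimately have "\<bar>F t - F 0 - t\<^sup>2 * ((H *v k) \<bullet> h)\<bar> \<le> t * (e * t)"
      using t by (simp add: abs_mult)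
    then show ?thesis by (simp add: F_def power2_eq_square algebra_simps)
  qed
  ultimately show ?thesis by blast
qed

lemma has_2jet_symmetric:
  assumes J: "has_2jet f g H x"
  shows "H \<in> symmetric_matrices"
proof -
  have eq: "(H *v k) \<bullet> h = (H *v h) \<bullet> k" for h k
  proof (rule ccontr)
    define e where "e = \<bar>(H *v k) \<bullet> h - (H *v h) \<bullet> k\<bar> / 3"
    assume "(H *v k) \<bullet> h \<noteq> (H *v h) \<bullet> k"
    then have "e > 0" by (simp add: e_def)
    obtain d1 where d1: "d1 > 0" "\<And>t. 0 < t \<Longrightarrow> t < d1 \<Longrightarrow>
        \<bar>f (x + t *\<^sub>R h + t *\<^sub>R k) - f (x + t *\<^sub>R h) - f (x + t *\<^sub>R k) + f x - t\<^sup>2 * ((H *v k) \<bullet> h)\<bar> \<le> e * t\<^sup>2"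
      using has_2jet_mixed_difference[OF J \<open>e > 0\<close>] by blast
    obtain d2 where d2: "d2 > 0" "\<And>t. 0 < t \<Longrightarrow> t < d2 \<Longrightarrow>
        \<bar>f (x + t *\<^sub>R k + t *\<^sub>R h) - f (x + t *\<^sub>R k) - f (x + t *\<^sub>R h) + f x - t\<^sup>2 * ((H *v h) \<bullet> k)\<bar> \<le> e * t\<^sup>2"
      using has_2jet_mixed_difference[OF J \<open>e > 0\<close>] by blast
    define t where "t = min d1 d2 / 2"
    have t: "0 < t" "t < d1" "t < d2" using d1 d2 by (auto simp: t_def)
    have "f (x + t *\<^sub>R k + t *\<^sub>R h) = f (x + t *\<^sub>R h + t *\<^sub>R k)" by (simp add: add_ac)
    then have "\<bar>t\<^sup>2 * ((H *v k) \<bullet> h) - t\<^sup>2 * ((H *v h) \<bullet> k)\<bar> \<le> 2 * (e * t\<^sup>2)"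
      using d1(2)[OF t(1,2)] d2(2)[OF t(1,3)] by linarith
    moreover have "\<bar>t\<^sup>2 * a - t\<^sup>2 * b\<bar> = t\<^sup>2 * \<bar>a - b\<bar>" for a b :: real
      by (simp add: right_diff_distrib[symmetric] abs_mult)
    ultimately have "t\<^sup>2 * \<bar>(H *v k) \<bullet> h - (H *v h) \<bullet> k\<bar> \<le> t\<^sup>2 * (2 * e)"
      by (simp add: mult_ac)
    then have "\<bar>(H *v k) \<bullet> h - (H *v h) \<bullet> k\<bar> \<le> 2 * e" using t by simp
    then show False using \<open>e > 0\<close> by (simp add: e_def)
  qed
  have "H $ i $ j = H $ j $ i" for i j
    using eq[of "axis j 1" "axis i 1"] by (simp add: inner_axis matrix_vector_mult_basis column_def)
  then show ?thesis by (simp add: symmetric_matrices_def transpose_def vec_eq_iff)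
qed

definition positive_semidefinite :: "real^'n^'n \<Rightarrow> bool" where
  "positive_semidefinite P \<longleftrightarrow> P \<in> symmetric_matrices \<and> (\<forall>x. x \<bullet> (P *v x) \<ge> 0)"

lemma symmetric_matrices_nth: "P \<in> symmetric_matrices \<Longrightarrow> P $ i $ j = P $ j $ i"
  unfolding symmetric_matrices_def transpose_def by (auto simp: vec_eq_iff)

lemma symmetric_matricesI: "(\<And>i j. P $ i $ j = P $ j $ i) \<Longrightarrow> P \<in> symmetric_matrices"
  unfolding symmetric_matrices_def transpose_def by (auto simp: vec_eq_iff)

lemma outer_symmetric: "outer x \<in> symmetric_matrices"
  by (rule symmetric_matricesI) (simp add: outer_def)

lemma subspace_symmetric_matrices: "subspace symmetric_matrices"
  unfolding subspace_def
  by (auto intro!: symmetric_matricesI intro: arg_cong2[where f = "(+)"] simp: symmetric_matrices_nth)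

lemma outer_quadratic: "outer x \<bullet> (G::real^'n^'n) = x \<bullet> (G *v x)"
  by (simp add: outer_def inner_vec_def matrix_vector_mult_def sum_distrib_left mult_ac)

lemma positive_semidefinite_zero_diagonal:
  assumes P: "positive_semidefinite P" and "P $ i $ i = 0"
  shows "P $ i = 0"
proof (rule ccontr)
  assume "P $ i \<noteq> 0"
  then obtain j where j: "P $ i $ j \<noteq> 0" by (auto simp: vec_eq_iff)
  have q: "x \<bullet> (P *v x) \<ge> 0" for x using P by (simp add: positive_semidefinite_def)
  have sym: "P $ j $ i = P $ i $ j"
    using P symmetric_matrices_nth by (auto simp: positive_semidefinite_def)
  have e: "(axis j 1 + t *\<^sub>R axis i 1) \<bullet> (P *v (axis j 1 + t *\<^sub>R axis i 1)) = P $ j $ j + 2 * t * P $ i $ j"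
    for t :: real
    using assms(2) sym
    by (simp add: matrix_vector_right_distrib matrix_vector_mult_scaleR inner_add_left inner_axis'
        matrix_vector_mult_basis column_def)
  have "P $ j $ j + 2 * (- (P $ j $ j + 1) / (2 * P $ i $ j)) * P $ i $ j = -1"
    using j by (simp add: field_simps)
  with q[of "axis j 1 + (- (P $ j $ j + 1) / (2 * P $ i $ j)) *\<^sub>R axis i 1"] e show False
    by simp
qed

text \<open>
  Cholesky elimination: subtracting the rank-one matrix built from a nonzero row clears that row, leaves
  cleared rows cleared, and keeps the remainder positive semidefinite. Repeating this writes \<open>P\<close> as a sum
  of rank-one matrices. It is the device by which ellipticity, tested on rank-one matrices, controls
  the nonnegative Hessian at an interior minimum.
\<close>

lemma positive_semidefinite_form_nonneg:
  fixes L :: "real^'n^'n \<Rightarrow> real"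
  assumes L: "linear L" and rank1: "\<And>x. L (outer x) \<ge> 0"
  shows "positive_semidefinite P \<Longrightarrow> L P \<ge> 0"
proof (induction "card {i. P $ i \<noteq> 0}" arbitrary: P rule: less_induct)
  case less
  show ?case
  proof (cases "P = 0")
    case True then show ?thesis using linear_0[OF L] by simp
  next
    case False
    then obtain i where i: "P $ i \<noteq> 0" by (auto simp: vec_eq_iff)
    have sym: "P $ j $ k = P $ k $ j" for j k
      using less.prems symmetric_matrices_nth by (auto simp: positive_semidefinite_def)
    have q: "x \<bullet> (P *v x) \<ge> 0" for x using less.prems by (simp add: positive_semidefinite_def)
    define p where "p = P $ i $ i"
    have "p \<ge> 0" using q[of "axis i 1"] by (simp add: p_def inner_axis' matrix_vector_mult_basis column_def)
    moreover have "p \<noteq> 0" using positive_semidefinite_zero_diagonal[OF less.prems] i by (auto simp: p_def)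
    ultimately have p: "p > 0" by simp
    define Q where "Q = P - (1 / p) *\<^sub>R outer (P $ i)"
    have Qv: "x \<bullet> (Q *v x) = x \<bullet> (P *v x) - (P $ i \<bullet> x)\<^sup>2 / p" for x
      by (simp add: Q_def matrix_vector_mult_diff_rdistrib scaleR_matrix_vector outer_mult_vec inner_diff_right
          power2_eq_square inner_commute)
    have Q: "positive_semidefinite Q"
      unfolding positive_semidefinite_def
    proof (intro conjI allI)
      show "Q \<in> symmetric_matrices"
        by (rule symmetric_matricesI) (simp add: Q_def outer_def sym)
      fix x
      define b where "b = P $ i \<bullet> x"
      \<comment> \<open>Completing the square in the coordinate \<open>i\<close>.\<close>
      define y where "y = x - (b / p) *\<^sub>R axis i 1"
      have Pi: "(P *v x) $ i = b" by (simp add: b_def matrix_vector_mult_def inner_vec_def)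
      have xP: "x \<bullet> column i P = b" by (simp add: b_def column_def inner_vec_def sym[of _ i] mult.commute)
      have "y \<bullet> (P *v y) = x \<bullet> (P *v x) - b\<^sup>2 / p"
        using p by (simp add: y_def matrix_vector_mult_diff_distrib matrix_vector_mult_scaleR inner_diff_left
            inner_diff_right inner_axis' matrix_vector_mult_basis Pi xP)
          (simp add: column_def p_def[symmetric] power2_eq_square field_simps)
      then show "0 \<le> x \<bullet> (Q *v x)" using q[of y] by (simp add: Qv b_def)
    qed
    have "Q $ j = 0" if "P $ j = 0" for j
    proof -
      have "P $ i $ j = 0" using that sym[of i j] by simp
      then show ?thesis using that by (simp add: Q_def outer_def vec_eq_iff)
    qed
    moreover have "Q $ i = 0" using p by (simp add: Q_def outer_def vec_eq_iff p_def)
    ultimately have "{j. Q $ j \<noteq> 0} \<subset> {j. P $ j \<noteq> 0}" using i by blast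
    then have "card {j. Q $ j \<noteq> 0} < card {j. P $ j \<noteq> 0}" by (intro psubset_card_mono) auto
    from less.hyps[OF this Q] have "L Q \<ge> 0" .
    moreover have "L P = L Q + (1 / p) * L (outer (P $ i))"
    proof -
      have "P = Q + (1 / p) *\<^sub>R outer (P $ i)" by (simp add: Q_def)
      then have "L P = L (Q + (1 / p) *\<^sub>R outer (P $ i))" by simp
      then show ?thesis by (simp only: linear_add[OF L] linear_scale[OF L] real_scaleR_def)
    qed
    ultimately show ?thesis using rank1[of "P $ i"] p by simp
  qed
qed

section \<open>Superharmonic functions on a punctured ball\<close>

lemma has_2jet_isCont: "has_2jet f g H x \<Longrightarrow> isCont f x"
  using has_2jet_gradient has_derivative_continuous by blast

lemma has_2jet_local_min_trace:
  assumes "has_2jet f g H x" "open S" "x \<in> S" "\<And>y. y \<in> S \<Longrightarrow> f x \<le> f y"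
  shows "trace H \<ge> 0"
  by (rule trace_nonnegI) (rule has_2jet_local_min(2)[OF assms])

text \<open>
  In dimension at least two \<open>- ln (norm x)\<close> is superharmonic off the origin and tends to infinity at the
  origin. A small multiple of it added to \<open>w\<close> keeps the minimum away from the puncture; the additional
  term \<open>r\<^sup>2 - (norm x)\<^sup>2\<close>, which also vanishes on the sphere, makes the Laplacian strictly negative, so that
  the minimum cannot be attained in the interior.
\<close>

lemma punctured_ball_minimum_principle:
  fixes w :: "real^'n \<Rightarrow> real"
  assumes n: "CARD('n) \<ge> 2"
    and cont: "continuous_on (cball 0 r - {0}) w"
    and jet: "\<And>x. x \<in> ball 0 r - {0} \<Longrightarrow> has_2jet w g (H x) x"
    and tr: "\<And>x. x \<in> ball 0 r - {0} \<Longrightarrow> trace (H x) \<le> 0"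
    and bdd: "\<And>x. x \<in> cball 0 r - {0} \<Longrightarrow> w x \<ge> B"
    and sphere: "\<And>x. norm x = r \<Longrightarrow> w x \<ge> m"
    and x0: "x0 \<in> cball 0 r - {0}"
  shows "w x0 \<ge> m"
proof (rule ccontr)
  assume "\<not> ?thesis"
  then have less: "w x0 < m" by simp
  have r: "r > 0" using x0 by (metis Diff_iff dist_0_norm insertCI linorder_not_le mem_cball norm_le_zero_iff order_trans)
  define F where "F = (\<lambda>s. (ln (r\<^sup>2) - ln s) / 2 + (r\<^sup>2 - s))"
  define F' where "F' = (\<lambda>s::real. - 1 / (2 * s) - 1)"
  define b where "b = (\<lambda>x::real^'n. F ((x - 0) \<bullet> (x - 0)))"
  have b_norm: "b x = (ln r - ln (norm x)) + (r\<^sup>2 - (norm x)\<^sup>2)" if "x \<noteq> 0" for x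
    using that r by (simp add: b_def F_def dot_square_norm ln_realpow)
  have b_nonneg: "b x \<ge> 0" if "x \<in> cball 0 r - {0}" for x
    using that r by (auto simp: b_norm intro!: add_nonneg_nonneg power_mono)
  have b_sphere: "b x = 0" if "norm x = r" for x
    using that r b_norm[of x] by auto
  define \<eta> where "\<eta> = (m - w x0) / (2 * (b x0 + 1))"
  have \<eta>: "\<eta> > 0" using less b_nonneg[OF x0] by (simp add: \<eta>_def)
  have "\<eta> * b x0 < m - w x0"
  proof -
    have "\<eta> * b x0 \<le> \<eta> * (b x0 + 1)" using \<eta> by simp
    also have "\<dots> = (m - w x0) / 2"
    proof -
      have "k / (2 * c) * c = k / 2" if "c > 0" for k c :: real using that by simp
      then show ?thesis using b_nonneg[OF x0] unfolding \<eta>_def by (meson add_nonneg_pos zero_less_one)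
    qed
    finally show ?thesis using less by simp
  qed
  define W where "W = (\<lambda>x. w x + \<eta> * b x)"
  have W0: "W x0 < m" using \<open>\<eta> * b x0 < m - w x0\<close> by (simp add: W_def)
  \<comment> \<open>Chosen so that within distance \<open>s\<close> of the origin the logarithmic term lifts the lower bound \<open>B\<close> above \<open>m\<close>.\<close>
  define s where "s = min (norm x0 / 2) (r * exp (- (\<bar>m - B\<bar> / \<eta>)))"
  have s: "s > 0" "s < norm x0" "s < r"
    using x0 r by (auto simp: s_def min_less_iff_disj)
  have near0: "W x \<ge> m" if "x \<noteq> 0" "norm x \<le> s" for x
  proof -
    have x: "x \<in> cball 0 r - {0}" using that s by auto
    have "ln (norm x) \<le> ln (r * exp (- (\<bar>m - B\<bar> / \<eta>)))"
      using that by (intro ln_mono) (auto simp: s_def)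
    then have "\<bar>m - B\<bar> / \<eta> \<le> ln r - ln (norm x)" using r by (simp add: ln_mult)
    also have "\<dots> \<le> b x" using that s b_norm[of x] by (auto intro!: power_mono)
    finally have "\<bar>m - B\<bar> \<le> \<eta> * b x" using \<eta> by (simp add: field_simps)
    then show ?thesis using bdd[OF x] by (simp add: W_def)
  qed
  define K where "K = cball (0::real^'n) r - ball 0 s"
  have K: "compact K" "x0 \<in> K" "K \<subseteq> cball 0 r - {0}"
    using x0 s by (auto simp: K_def compact_diff)
  have "continuous_on K W"
    unfolding W_def b_def F_def using K(3)
    by (intro continuous_intros continuous_on_subset[OF cont]) auto
  then obtain xm where xm: "xm \<in> K" "\<And>x. x \<in> K \<Longrightarrow> W xm \<le> W x"
    using continuous_attains_inf[OF K(1), of W] K(2) by blast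
  have Wm: "W xm < m" using xm(2)[OF K(2)] W0 by simp
  have xm0: "xm \<noteq> 0" using xm(1) K(3) by auto
  have "norm xm \<noteq> r" using Wm b_sphere[of xm] sphere[of xm] by (auto simp: W_def)
  moreover have "norm xm > s" using near0[OF xm0] Wm by force
  ultimately have int: "xm \<in> ball 0 r - cball 0 s" using xm(1) by (auto simp: K_def)
  let ?t = "(xm - 0) \<bullet> (xm - 0)"
  have t: "?t > 0" using xm0 by simp
  have "has_2jet b (\<lambda>y. (2 * F' ((y - 0) \<bullet> (y - 0))) *\<^sub>R (y - 0))
      ((2 * F' ?t) *\<^sub>R mat 1 + (4 * (1 / (2 * ?t\<^sup>2))) *\<^sub>R outer (xm - 0)) xm" (is "has_2jet b ?g ?G xm")
    unfolding b_def
  proof (rule has_2jet_radial[of "{0<..}"])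
    show "(F has_real_derivative F' s) (at s)" if "s \<in> {0<..}" for s
      unfolding F_def F'_def using that
      by (auto intro!: derivative_eq_intros simp: field_simps)
    show "(F' has_real_derivative 1 / (2 * ?t\<^sup>2)) (at ?t)"
      unfolding F'_def using t
      by (auto intro!: derivative_eq_intros simp: field_simps power2_eq_square)
  qed (use t in auto)
  from has_2jet_add[OF jet has_2jet_scale[OF this, of \<eta>]]
  have "has_2jet W (\<lambda>y. g y + \<eta> *\<^sub>R ?g y) (H xm + \<eta> *\<^sub>R ?G) xm"
    using int s xm0 unfolding W_def by auto
  from has_2jet_local_min_trace[OF this, where S = "ball 0 r - cball 0 s"] int xm(2)
  have "0 \<le> trace (H xm + \<eta> *\<^sub>R ?G)" by (auto simp: K_def)
  moreover have "trace ?G < 0"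
  proof -
    have "trace ?G = - (real CARD('n) - 2) / ?t - 2 * real CARD('n)"
      using t by (simp add: trace_add trace_scaleR trace_I trace_outer F'_def field_simps power2_eq_square)
    also have "\<dots> < 0"
    proof -
      have n': "real CARD('n) \<ge> 2" using n by simp
      then have "- (real CARD('n) - 2) / ?t \<le> 0" using t by (intro divide_nonpos_pos) auto
      then show ?thesis using n' by linarith
    qed
    finally show ?thesis .
  qed
  moreover have "trace (H xm) \<le> 0" using tr[of xm] int s xm0 by auto
  ultimately show False using \<eta> by (simp add: trace_add trace_scaleR) (smt (verit) mult_pos_neg)
qed

text \<open>
  With \<open>a\<close> the mean and \<open>e\<close> half the difference of the two gradients, the minorants give
  \<open>u x \<ge> v 0 + a \<bullet> x + \<bar>e \<bullet> x\<bar>\<close> up to an error that is small compared with \<open>norm x\<close>. On the sphere of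
  radius \<open>r\<close> the modulus dominates \<open>(e \<bullet> x)\<^sup>2 / (r * norm e)\<close>; the harmonic function with these boundary
  values is a quadratic polynomial whose value at the centre is a positive multiple of \<open>r\<close>, and it
  dominates the error once \<open>r\<close> is small.
\<close>

lemma two_touching_minorants:
  fixes u v w :: "real^'n \<Rightarrow> real"
  assumes n: "CARD('n) \<ge> 2" and R: "R > 0"
    and jet: "\<And>x. x \<in> ball 0 R - {0} \<Longrightarrow> has_2jet u g (H x) x"
    and tr: "\<And>x. x \<in> ball 0 R - {0} \<Longrightarrow> trace (H x) \<le> 0"
    and uv: "\<And>x. x \<in> ball 0 R - {0} \<Longrightarrow> u x \<ge> v x"
    and uw: "\<And>x. x \<in> ball 0 R - {0} \<Longrightarrow> u x \<ge> w x"
    and v: "(v has_derivative (\<lambda>h. p \<bullet> h)) (at 0)"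
    and w: "(w has_derivative (\<lambda>h. q \<bullet> h)) (at 0)"
    and eq0: "v 0 = w 0" and ne: "p \<noteq> q"
  shows "\<exists>\<eta>>0. \<exists>\<rho>>0. \<forall>x. 0 < norm x \<and> norm x < \<rho> \<longrightarrow> u x \<ge> v 0 + \<eta>"
proof -
  define e a where "e = (1/2) *\<^sub>R (p - q)" and "a = (1/2) *\<^sub>R (p + q)"
  have pq: "p = a + e" "q = a - e"
    by (simp_all add: e_def a_def algebra_simps flip: scaleR_left_distrib)
  define N where "N = norm e"
  have N: "N > 0" using ne by (simp add: N_def e_def)
  define n where "n = real CARD('n)"
  have n0: "n > 0" by (simp add: n_def)
  \<comment> \<open>Half of the gain \<open>N * r / n\<close> of the harmonic polynomial at the centre is left over after an error of
     \<open>\<kappa> * r\<close>.\<close>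
  define \<kappa> where "\<kappa> = N / (2 * n)"
  have \<kappa>: "\<kappa> > 0" using N n0 by (simp add: \<kappa>_def)
  define \<alpha> where "\<alpha> = v 0"
  obtain d1 where d1: "d1 > 0" "\<And>x. norm x < d1 \<Longrightarrow> \<bar>v x - v 0 - p \<bullet> x\<bar> \<le> \<kappa> * norm x"
    using v \<kappa> unfolding has_derivative_at_alt by force
  obtain d2 where d2: "d2 > 0" "\<And>x. norm x < d2 \<Longrightarrow> \<bar>w x - w 0 - q \<bullet> x\<bar> \<le> \<kappa> * norm x"
    using w \<kappa> unfolding has_derivative_at_alt by force
  define r where "r = Min {d1, d2, R} / 2"
  have r: "0 < r" "r < d1" "r < d2" "r < R" using d1 d2 R by (auto simp: r_def)
  have cone: "u x \<ge> \<alpha> + a \<bullet> x + \<bar>e \<bullet> x\<bar> - \<kappa> * norm x" if "x \<in> cball 0 r - {0}" for x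
    using uv[of x] uw[of x] d1(2)[of x] d2(2)[of x] that r eq0
    by (auto simp: pq \<alpha>_def inner_add_left inner_diff_left abs_if split: if_splits)
  define F where "F = (\<lambda>s::real. - (N / (n * r)) * (s - r\<^sup>2))"
  define h where "h = (\<lambda>x. ((\<alpha> - \<kappa> * r) + a \<bullet> x) + ((1 / (N * r)) * (e \<bullet> x)\<^sup>2 + F ((x - 0) \<bullet> (x - 0))))"
  define hg where "hg = (\<lambda>x. a + ((1 / (N * r)) *\<^sub>R ((2 * (e \<bullet> x)) *\<^sub>R e) + (2 * - (N / (n * r))) *\<^sub>R (x - 0)))"
  define hH where "hH x = 0 + ((1 / (N * r)) *\<^sub>R (2 *\<^sub>R outer e) +
    ((2 * - (N / (n * r))) *\<^sub>R mat 1 + (4 * 0) *\<^sub>R outer (x - 0)))" for x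
  have hjet: "has_2jet h hg (hH x) x" for x
    unfolding h_def hg_def hH_def
    by (intro has_2jet_add has_2jet_affine has_2jet_scale has_2jet_square has_2jet_radial[of UNIV])
       (use n0 r(1) in \<open>auto simp: F_def intro!: derivative_eq_intros\<close>)
  have hcont: "continuous_on S h" for S
    using has_2jet_isCont[OF hjet] continuous_at_imp_continuous_on by blast
  have htr: "trace (hH x) = 0" for x
  proof -
    have "trace (hH x) = 1 / (N * r) * (2 * N\<^sup>2) + 2 * - (N / (n * r)) * n"
      by (simp add: hH_def trace_add trace_sub trace_scaleR trace_I trace_outer
          dot_square_norm N_def[symmetric] n_def[symmetric])
    also have "\<dots> = 0" using N n0 r(1) by (simp add: power2_eq_square field_simps)
    finally show ?thesis .
  qed
  have hsphere: "h x \<le> u x" if x: "norm x = r" for x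
  proof -
    have "\<bar>e \<bullet> x\<bar> \<le> N * r" using Cauchy_Schwarz_ineq2[of e x] x by (simp add: N_def)
    then have "\<bar>e \<bullet> x\<bar> * \<bar>e \<bullet> x\<bar> \<le> \<bar>e \<bullet> x\<bar> * (N * r)" by (intro mult_left_mono) auto
    then have "(1 / (N * r)) * (e \<bullet> x)\<^sup>2 \<le> \<bar>e \<bullet> x\<bar>"
      using N r by (simp add: power2_eq_square field_simps abs_mult_self_eq)
    moreover have "F ((x - 0) \<bullet> (x - 0)) = 0" using x by (simp add: F_def dot_square_norm)
    ultimately show ?thesis using cone[of x] x r by (auto simp: h_def)
  qed
  have "continuous_on (cball 0 r) (\<lambda>x. \<alpha> + a \<bullet> x - \<kappa> * norm x - h x)"
    by (intro continuous_intros hcont)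
  then have "\<exists>y\<in>cball 0 r. \<forall>x\<in>cball 0 r.
      \<alpha> + a \<bullet> y - \<kappa> * norm y - h y \<le> \<alpha> + a \<bullet> x - \<kappa> * norm x - h x"
    using r(1) by (intro continuous_attains_inf) auto
  then obtain y where y: "\<And>x. x \<in> cball 0 r \<Longrightarrow> \<alpha> + a \<bullet> y - \<kappa> * norm y - h y \<le> \<alpha> + a \<bullet> x - \<kappa> * norm x - h x"
    by blast
  have uh: "u x - h x \<ge> 0" if "x \<in> cball 0 r - {0}" for x
  proof (rule punctured_ball_minimum_principle[OF assms(1) _ _ _ _ _ that])
    show "has_2jet (\<lambda>x. u x - h x) (\<lambda>x. g x - hg x) (H x - hH x) x" if "x \<in> ball 0 r - {0}" for x
      using that r by (intro has_2jet_minus jet hjet) auto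
    show "continuous_on (cball 0 r - {0}) (\<lambda>x. u x - h x)"
      using r by (intro continuous_intros hcont continuous_at_imp_continuous_on ballI has_2jet_isCont[OF jet]) auto
    show "trace (H x - hH x) \<le> 0" if "x \<in> ball 0 r - {0}" for x
      using tr[of x] that r by (auto simp: trace_sub htr)
    show "\<alpha> + a \<bullet> y - \<kappa> * norm y - h y \<le> u x - h x" if "x \<in> cball 0 r - {0}" for x
      using y[of x] cone[OF that] that by auto
    show "u x - h x \<ge> 0" if "norm x = r" for x using hsphere[OF that] by simp
  qed
  have h0: "h 0 = \<alpha> + \<kappa> * r"
    using n0 r by (simp add: h_def F_def \<kappa>_def power2_eq_square field_simps)
  define \<eta> where "\<eta> = \<kappa> * r / 2"
  have \<eta>: "\<eta> > 0" using \<kappa> r by (simp add: \<eta>_def)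
  have "isCont h 0" by (rule has_2jet_isCont[OF hjet])
  then obtain d where d: "d > 0" "\<And>x. norm x < d \<Longrightarrow> \<bar>h x - h 0\<bar> < \<eta>"
    using \<eta> unfolding continuous_at_eps_delta dist_norm by force
  show ?thesis
  proof (intro exI conjI allI impI)
    show "u x \<ge> v 0 + \<eta>" if "0 < norm x \<and> norm x < min d r" for x
    proof -
      have "\<bar>h x - h 0\<bar> < \<eta>" using d(2) that by auto
      moreover have "u x - h x \<ge> 0" using uh[of x] that by auto
      moreover have "h 0 = \<alpha> + 2 * \<eta>" using h0 by (simp add: \<eta>_def)
      ultimately show ?thesis unfolding \<alpha>_def by linarith
    qed
    show "min d r > 0" using d r by simp
  qed (rule \<eta>)
qed

section \<open>Linearisation of an elliptic operator\<close>

lemma inner_symmetrized: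
  fixes G :: "real^'n^'n"
  assumes "N \<in> symmetric_matrices"
  shows "((1/2) *\<^sub>R (G + transpose G)) \<bullet> N = G \<bullet> N"
proof -
  have "transpose G \<bullet> N = (\<Sum>i\<in>UNIV. \<Sum>j\<in>UNIV. G $ j $ i * N $ i $ j)"
    by (simp add: inner_vec_def transpose_def)
  also have "\<dots> = (\<Sum>j\<in>UNIV. \<Sum>i\<in>UNIV. G $ j $ i * N $ i $ j)" by (rule sum.swap)
  also have "\<dots> = G \<bullet> N"
    using symmetric_matrices_nth[OF assms] by (simp add: inner_vec_def)
  finally show ?thesis by (simp add: inner_add_left)
qed

text \<open>
  Behind the definite description there is exactly one symmetric matrix. It exists because the linear
  form \<open>D\<close> has a representing matrix, which may be symmetrised without changing its values on symmetric
  matrices. It is unique because the derivative along a line of symmetric matrices determines \<open>D\<close> on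
  symmetric directions.
\<close>

lemma matrix_partials_eq:
  fixes F :: "real^'n^'n \<Rightarrow> real"
  assumes D: "(F has_derivative D) (at M within symmetric_matrices)"
    and M: "M \<in> symmetric_matrices" and N: "N \<in> symmetric_matrices"
  shows "matrix_partials F M \<bullet> N = D N"
proof -
  have lin: "linear D" using D has_derivative_linear by blast
  define G where "G = (1/2) *\<^sub>R (adjoint D 1 + transpose (adjoint D 1))"
  have GD: "G \<bullet> N = D N" if "N \<in> symmetric_matrices" for N
    unfolding G_def inner_symmetrized[OF that]
    using adjoint_works[OF lin, of N 1] by (simp add: inner_commute)
  have Gsym: "G \<in> symmetric_matrices"
    by (rule symmetric_matricesI) (simp add: G_def transpose_def)
  have "(F has_derivative (\<lambda>N. G \<bullet> N)) (at M within symmetric_matrices)"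
    unfolding has_derivative_within
  proof
    show "bounded_linear ((\<bullet>) G)" by (rule bounded_linear_inner_right)
    have "((\<lambda>y. (1 / norm (y - M)) *\<^sub>R (F y - (F M + D (y - M)))) \<longlongrightarrow> 0) (at M within symmetric_matrices)"
      using D by (simp add: has_derivative_within)
    moreover have "\<forall>\<^sub>F y in at M within symmetric_matrices.
        (1 / norm (y - M)) *\<^sub>R (F y - (F M + D (y - M))) = (1 / norm (y - M)) *\<^sub>R (F y - (F M + G \<bullet> (y - M)))"
      unfolding eventually_at_filter
      using GD subspace_diff[OF subspace_symmetric_matrices _ M] by (intro always_eventually) auto
    ultimately show "((\<lambda>y. (1 / norm (y - M)) *\<^sub>R (F y - (F M + G \<bullet> (y - M)))) \<longlongrightarrow> 0)
        (at M within symmetric_matrices)"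
      by (rule Lim_transform_eventually)
  qed
  moreover have "G' = G" if G': "G' \<in> symmetric_matrices"
      "(F has_derivative (\<lambda>N. G' \<bullet> N)) (at M within symmetric_matrices)" for G'
  proof -
    have eq: "G' \<bullet> N = D N" if N: "N \<in> symmetric_matrices" for N
    proof -
      have L: "((\<lambda>t. M + t *\<^sub>R N) has_derivative (\<lambda>t. t *\<^sub>R N)) (at 0)"
        by (auto intro!: derivative_eq_intros)
      have sub: "range (\<lambda>t. M + t *\<^sub>R N) \<subseteq> symmetric_matrices"
        using M N subspace_symmetric_matrices by (auto intro: subspace_add subspace_scale)
      have *: "((\<lambda>t. F (M + t *\<^sub>R N)) has_derivative (\<lambda>t. A (t *\<^sub>R N))) (at 0)"
        if "(F has_derivative A) (at M within symmetric_matrices)" for A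
        by (rule has_derivative_in_compose[OF L]) (simp add: has_derivative_subset[OF that sub])
      have "(\<lambda>t. G' \<bullet> (t *\<^sub>R N)) = (\<lambda>t. D (t *\<^sub>R N))"
        using has_derivative_unique[OF *[OF G'(2)] *[OF D]] .
      from fun_cong[OF this, of 1] show ?thesis by simp
    qed
    have S: "G' - G \<in> symmetric_matrices"
      by (rule subspace_diff[OF subspace_symmetric_matrices G'(1) Gsym])
    have "(G' - G) \<bullet> (G' - G) = 0" using eq[OF S] GD[OF S] by (simp add: inner_diff_left)
    then show ?thesis by simp
  qed
  ultimately have "matrix_partials F M = G"
    unfolding matrix_partials_def using Gsym by (intro the_equality) blast+
  then show ?thesis using GD[OF N] by simp
qed

abbreviation (input) jet_domain :: "(real \<times> (real^'n) \<times> (real^'n^'n)) set" where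
  "jet_domain \<equiv> {0<..} \<times> UNIV \<times> symmetric_matrices"

text \<open>
  Ellipticity is recorded on rank-one matrices only; positive semidefinite directions are sums of these.
\<close>

definition elliptic_derivative ::
    "(real \<Rightarrow> real^'n \<Rightarrow> real^'n^'n \<Rightarrow> real) \<Rightarrow>
     (real \<times> (real^'n) \<times> (real^'n^'n) \<Rightarrow> (real \<times> (real^'n) \<times> (real^'n^'n)) \<Rightarrow>\<^sub>L real) \<Rightarrow> bool" where
  "elliptic_derivative T DT \<longleftrightarrow>
     continuous_on jet_domain DT \<and>
     (\<forall>z\<in>jet_domain. ((\<lambda>(s, p, M). T s p M) has_derivative blinfun_apply (DT z)) (at z within jet_domain)) \<and>
     (\<forall>z\<in>jet_domain. \<forall>x. x \<noteq> 0 \<longrightarrow> blinfun_apply (DT z) (0, 0, outer x) < 0)"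

lemma elliptic_derivative_exists:
  fixes T :: "real \<Rightarrow> real^'n \<Rightarrow> real^'n^'n \<Rightarrow> real"
  assumes T_C1: "C1_on (\<lambda>(s, p, M). T s p M) ({0<..} \<times> UNIV \<times> symmetric_matrices)"
    and T_elliptic: "\<And>s p M. s > 0 \<Longrightarrow> M \<in> symmetric_matrices \<Longrightarrow>
          positive_definite (- matrix_partials (T s p) M)"
  shows "\<exists>DT. elliptic_derivative T DT"
proof -
  obtain DT where DT: "continuous_on jet_domain DT"
    "\<And>z. z \<in> jet_domain \<Longrightarrow> ((\<lambda>(s, p, M). T s p M) has_derivative blinfun_apply (DT z)) (at z within jet_domain)"
    using T_C1 unfolding C1_on_def by blast
  have "blinfun_apply (DT z) (0, 0, outer x) < 0" if z: "z \<in> jet_domain" and x: "x \<noteq> 0" for z x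
  proof -
    obtain s p M where zeq: "z = (s, p, M)" by (cases z)
    have s: "s > 0" and M: "M \<in> symmetric_matrices" using z zeq by auto
    have L: "((\<lambda>N. (s, p, N)) has_derivative (\<lambda>N. (0, 0, N))) (at M within symmetric_matrices)"
      by (intro has_derivative_Pair has_derivative_const has_derivative_ident)
    have "((\<lambda>N. (\<lambda>(s, p, M). T s p M) (s, p, N)) has_derivative (\<lambda>N. blinfun_apply (DT z) (0, 0, N)))
        (at M within symmetric_matrices)"
      by (rule has_derivative_in_compose[OF L])
        (use DT(2)[OF z] zeq s in \<open>auto intro: has_derivative_subset\<close>)
    then have "(T s p has_derivative (\<lambda>N. blinfun_apply (DT z) (0, 0, N))) (at M within symmetric_matrices)"
      by simp
    from matrix_partials_eq[OF this M outer_symmetric[of x]]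
    have "blinfun_apply (DT z) (0, 0, outer x) = x \<bullet> (matrix_partials (T s p) M *v x)"
      by (metis inner_commute outer_quadratic)
    moreover have "x \<bullet> ((- matrix_partials (T s p) M) *v x) > 0"
      using T_elliptic[OF s M, of p] x unfolding positive_definite_def by blast
    moreover have "(- matrix_partials (T s p) M) *v x = - (matrix_partials (T s p) M *v x)"
      using scaleR_matrix_vector[of "-1" "matrix_partials (T s p) M" x] by simp
    ultimately show ?thesis by simp
  qed
  then show ?thesis using DT unfolding elliptic_derivative_def by blast
qed

lemma norm_triple_le: "norm (a, b, c) \<le> norm a + norm b + norm c"
  using norm_Pair_le[of a "(b, c)"] norm_Pair_le[of b c] by linarith

section \<open>The strong comparison principle\<close>

text \<open>
  Hopf's argument for the nonlinear operator. With \<open>h\<close> a Gaussian centred at \<open>z\<close>, minus its value on the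
  sphere, \<open>U - V - \<kappa> h\<close> has an interior minimum near the contact point \<open>y1\<close> for a small \<open>\<kappa>\<close>. At that
  minimum the difference of the jets of \<open>U\<close> and \<open>V\<close> is \<open>\<kappa>\<close> times the jet of \<open>h\<close>, up to a smaller
  nonnegative value in the zeroth order slot and a positive semidefinite matrix in the Hessian slot. The mean value theorem expresses the increment of \<open>T\<close>
  between both jets as a derivative applied to this difference; ellipticity makes it negative when the
  Gaussian is steep, whereas the increment is nonnegative by the two differential inequalities.
\<close>

lemma no_touching_at_interior_sphere_point:
  fixes T :: "real \<Rightarrow> real^'n \<Rightarrow> real^'n^'n \<Rightarrow> real"
  assumes DT: "elliptic_derivative T DT"
    and \<Omega>: "open \<Omega>"
    and U: "\<And>x. x \<in> \<Omega> \<Longrightarrow> has_2jet U gU (HU x) x" "continuous_on \<Omega> gU" "continuous_on \<Omega> HU"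
    and V: "\<And>x. x \<in> \<Omega> \<Longrightarrow> has_2jet V gV (HV x) x" "continuous_on \<Omega> gV" "continuous_on \<Omega> HV"
    and V_pos: "\<And>x. x \<in> \<Omega> \<Longrightarrow> V x > 0" and UV: "\<And>x. x \<in> \<Omega> \<Longrightarrow> U x \<ge> V x"
    and T_U: "\<And>x. x \<in> \<Omega> \<Longrightarrow> T (U x) (gU x) (HU x) \<ge> 0"
    and T_V: "\<And>x. x \<in> \<Omega> \<Longrightarrow> T (V x) (gV x) (HV x) \<le> 0"
    and \<rho>: "\<rho> > 0" "dist z y1 = \<rho>" and y1: "y1 \<in> \<Omega>" "U y1 = V y1"
    and strict: "\<And>y. y \<in> cball z \<rho> \<inter> \<Omega> \<Longrightarrow> y \<noteq> y1 \<Longrightarrow> U y > V y"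
  shows False
proof -
  let ?dom = "jet_domain :: (real \<times> (real^'n) \<times> (real^'n^'n)) set"
  have DTc: "continuous_on ?dom DT"
    and DTd: "\<And>z. z \<in> ?dom \<Longrightarrow> ((\<lambda>(s, p, M). T s p M) has_derivative blinfun_apply (DT z)) (at z within ?dom)"
    and DTneg: "\<And>z x. z \<in> ?dom \<Longrightarrow> x \<noteq> 0 \<Longrightarrow> blinfun_apply (DT z) (0, 0, outer x) < 0"
    using DT unfolding elliptic_derivative_def by blast+
  have Uc: "continuous_on \<Omega> U" and Vc: "continuous_on \<Omega> V"
    using has_2jet_isCont[OF U(1)] has_2jet_isCont[OF V(1)] continuous_at_imp_continuous_on by blast+
  obtain s0 where s0: "s0 > 0" "cball y1 s0 \<subseteq> \<Omega>" using \<Omega> y1 open_contains_cball by blast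
  define s where "s = min s0 (\<rho> / 2)"
  have s: "s > 0" "s \<le> \<rho> / 2" "cball y1 s \<subseteq> \<Omega>" using s0 \<rho> by (auto simp: s_def)
  define J where "J = (\<lambda>(y, t). (V y + t * (U y - V y), gV y + t *\<^sub>R (gU y - gV y), HV y + t *\<^sub>R (HU y - HV y)))"
  define Z where "Z = J ` (cball y1 s \<times> {0..1::real})"
  have cK: "continuous_on (cball y1 s \<times> {0..1::real}) (\<lambda>x. f (fst x))" if "continuous_on \<Omega> f"
    for f :: "real^'n \<Rightarrow> 'b::topological_space"
    by (rule continuous_on_compose2[OF that continuous_on_fst[OF continuous_on_id]]) (use s in auto)
  note cK' = cK[OF Uc] cK[OF Vc] cK[OF U(2)] cK[OF V(2)] cK[OF U(3)] cK[OF V(3)]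
  have "continuous_on (cball y1 s \<times> {0..1}) J"
    unfolding J_def case_prod_beta
    by (intro continuous_on_Pair continuous_on_add continuous_on_diff continuous_on_mult
        continuous_on_scaleR cK' continuous_on_snd continuous_on_id)
  then have "compact Z"
    unfolding Z_def by (intro compact_continuous_image compact_Times compact_cball compact_Icc)
  have J_dom: "J (y, t) \<in> ?dom" if "y \<in> \<Omega>" "0 \<le> t" "t \<le> 1" for y t
  proof -
    have "HV y \<in> symmetric_matrices" "HU y \<in> symmetric_matrices"
      using has_2jet_symmetric U(1) V(1) that(1) by blast+
    then have "HV y + t *\<^sub>R (HU y - HV y) \<in> symmetric_matrices"
      using subspace_symmetric_matrices by (intro subspace_add subspace_scale subspace_diff)
    moreover have "V y + t * (U y - V y) > 0"
      using V_pos[OF that(1)] UV[OF that(1)] that(2) by (intro add_pos_nonneg mult_nonneg_nonneg) auto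
    ultimately show ?thesis by (simp add: J_def)
  qed
  then have "J w \<in> ?dom" if "w \<in> cball y1 s \<times> {0..1}" for w
  proof -
    obtain y t where w: "w = (y, t)" by (cases w)
    show ?thesis unfolding w by (rule J_dom) (use that w s(3) in auto)
  qed
  then have Z_dom: "Z \<subseteq> ?dom" unfolding Z_def by blast
  have y1Z: "J (y1, 0) \<in> Z" using s unfolding Z_def by (intro imageI) auto
  obtain C where C: "C > 0" "\<And>z. z \<in> Z \<Longrightarrow> norm (DT z) \<le> C"
  proof -
    have "compact (DT ` Z)"
      by (intro compact_continuous_image continuous_on_subset[OF DTc Z_dom] \<open>compact Z\<close>)
    then have "bounded (DT ` Z)" by (rule compact_imp_bounded)
    then show ?thesis using that unfolding bounded_pos by blast
  qed
  \<comment> \<open>A uniform ellipticity constant over all jets between those of \<open>V\<close> and \<open>U\<close>: the quadratic form is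
     continuous on a compact set times the unit sphere and negative there.\<close>
  obtain \<theta> where \<theta>: "\<theta> > 0" "\<And>z x. z \<in> Z \<Longrightarrow> blinfun_apply (DT z) (0, 0, outer x) \<le> - \<theta> * (x \<bullet> x)"
  proof -
    let ?q = "\<lambda>w. blinfun_apply (DT (fst w)) (0, 0, outer (snd w))"
    have "continuous_on (Z \<times> sphere 0 1) (\<lambda>w. DT (fst w))"
      by (rule continuous_on_compose2[OF continuous_on_subset[OF DTc Z_dom] continuous_on_fst[OF continuous_on_id]]) auto
    then have "continuous_on (Z \<times> sphere 0 1) ?q"
      unfolding outer_def by (intro continuous_intros continuous_on_vec_lambda)
    moreover have "Z \<times> sphere (0::real^'n) 1 \<noteq> {}" using y1Z by auto
    ultimately have "\<exists>w\<in>Z \<times> sphere 0 1. \<forall>w'\<in>Z \<times> sphere 0 1. ?q w' \<le> ?q w"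
      by (intro continuous_attains_sup compact_Times \<open>compact Z\<close> compact_sphere)
    then obtain w where w: "w \<in> Z \<times> sphere 0 1" "\<And>w'. w' \<in> Z \<times> sphere 0 1 \<Longrightarrow> ?q w' \<le> ?q w"
      by blast
    show ?thesis
    proof (rule that)
      have "fst w \<in> ?dom" "snd w \<noteq> 0" using w(1) Z_dom by (auto simp: mem_Times_iff)
      then show "- ?q w > 0" using DTneg by simp
      fix z and x :: "real^'n" assume z: "z \<in> Z"
      show "blinfun_apply (DT z) (0, 0, outer x) \<le> - (- ?q w) * (x \<bullet> x)"
      proof (cases "x = 0")
        case True
        then have "(0, 0, outer x) = (0 :: real \<times> (real^'n) \<times> (real^'n^'n))"
          by (simp add: outer_def zero_prod_def vec_eq_iff)
        then show ?thesis using True by simp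
      next
        case False
        define e where "e = (1 / norm x) *\<^sub>R x"
        have "outer x = (x \<bullet> x) *\<^sub>R outer e"
          using False by (simp add: outer_def e_def vec_eq_iff power2_norm_eq_inner[symmetric] power2_eq_square)
        then have "(0::real, 0::real^'n, outer x) = (x \<bullet> x) *\<^sub>R (0, 0, outer e)" by simp
        then have "blinfun_apply (DT z) (0, 0, outer x) = (x \<bullet> x) * ?q (z, e)"
          by (simp only: blinfun.scaleR_right real_scaleR_def fst_conv snd_conv)
        also have "\<dots> \<le> (x \<bullet> x) * ?q w"
          using z False by (intro mult_left_mono w(2)) (auto simp: e_def)
        finally show ?thesis by (simp add: mult.commute)
      qed
    qed
  qed
  define I where "I = (mat 1 :: real^'n^'n)"
  define B where "B = 1 + 4 * \<rho> + 2 * norm I"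
  have B: "B > 0" unfolding B_def using \<rho>(1) norm_ge_zero[of I] by linarith
  \<comment> \<open>The rank-one part of the Hessian of the barrier grows like \<open>\<alpha>\<^sup>2\<close>, all other contributions like \<open>\<alpha>\<close>;
     \<open>B\<close> collects the latter.\<close>
  define \<alpha> where "\<alpha> = 1 + C * B / (\<theta> * \<rho>\<^sup>2)"
  have \<alpha>1: "\<alpha> \<ge> 1" using C B \<theta> by (simp add: \<alpha>_def)
  have \<alpha>2: "C * B < \<alpha> * (\<theta> * \<rho>\<^sup>2)"
    using \<rho> \<theta> by (simp add: \<alpha>_def field_simps)
  define F where "F = (\<lambda>t. exp (- \<alpha> * t) - exp (- \<alpha> * \<rho>\<^sup>2))"
  define F' where "F' = (\<lambda>t. - \<alpha> * exp (- \<alpha> * t))"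
  define h where "h = (\<lambda>y. F ((y - z) \<bullet> (y - z)))"
  define gh where "gh = (\<lambda>y. (2 * F' ((y - z) \<bullet> (y - z))) *\<^sub>R (y - z))"
  define Hh where "Hh y = (2 * F' ((y - z) \<bullet> (y - z))) *\<^sub>R I
      + (4 * (\<alpha>\<^sup>2 * exp (- \<alpha> * ((y - z) \<bullet> (y - z))))) *\<^sub>R outer (y - z)" for y
  have hjet: "has_2jet h gh (Hh y) y" for y
    unfolding h_def gh_def Hh_def I_def
    by (rule has_2jet_radial[of UNIV])
      (auto simp: F_def F'_def power2_eq_square intro!: derivative_eq_intros)
  have hc: "continuous_on S h" for S
    using has_2jet_isCont[OF hjet] continuous_at_imp_continuous_on by blast
  have barrier: "blinfun_apply (DT \<zeta>) (a, gh y, Hh y) < 0"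
    if \<zeta>: "\<zeta> \<in> Z" and y: "\<rho> / 2 \<le> norm (y - z)" "norm (y - z) \<le> 2 * \<rho>" and a: "0 \<le> a" "a \<le> h y" for \<zeta> y a
  proof -
    define E where "E = exp (- \<alpha> * ((y - z) \<bullet> (y - z)))"
    have E: "E > 0" by (simp add: E_def)
    have F'E: "F' ((y - z) \<bullet> (y - z)) = - \<alpha> * E" by (simp add: F'_def E_def)
    have split: "(a, gh y, Hh y) = (a, gh y, (2 * (- \<alpha> * E)) *\<^sub>R I) + (4 * (\<alpha>\<^sup>2 * E)) *\<^sub>R (0, 0, outer (y - z))"
      unfolding Hh_def F'E E_def[symmetric] by simp
    have "blinfun_apply (DT \<zeta>) (a, gh y, (2 * (- \<alpha> * E)) *\<^sub>R I)
        \<le> norm (DT \<zeta>) * norm (a, gh y, (2 * (- \<alpha> * E)) *\<^sub>R I)"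
      using norm_blinfun[of "DT \<zeta>"] abs_le_D1 by fastforce
    also have "\<dots> \<le> C * (E * \<alpha> * B)"
    proof (intro mult_mono C(2) \<zeta>)
      have "norm (a, gh y, (2 * (- \<alpha> * E)) *\<^sub>R I) \<le> norm a + norm (gh y) + norm ((2 * (- \<alpha> * E)) *\<^sub>R I)"
        by (rule norm_triple_le)
      also have "norm a \<le> E * \<alpha>"
      proof -
        have "norm a \<le> E" using a by (simp add: h_def F_def E_def) (smt (verit) exp_gt_zero)
        also have "E \<le> E * \<alpha>" using E \<alpha>1 by simp
        finally show ?thesis .
      qed
      also have "norm (gh y) \<le> E * \<alpha> * (4 * \<rho>)"
      proof -
        have "norm (gh y) = 2 * E * \<alpha> * norm (y - z)"
          using E \<alpha>1 by (simp add: gh_def F'E abs_mult)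
        also have "\<dots> \<le> 2 * E * \<alpha> * (2 * \<rho>)" using E \<alpha>1 y by (intro mult_left_mono) auto
        finally show ?thesis by simp
      qed
      also have "norm ((2 * (- \<alpha> * E)) *\<^sub>R I) = E * \<alpha> * (2 * norm I)"
        using E \<alpha>1 by (simp add: abs_mult)
      finally show "norm (a, gh y, (2 * (- \<alpha> * E)) *\<^sub>R I) \<le> E * \<alpha> * B"
        by (simp add: B_def distrib_left)
    qed (use C in auto)
    finally have 1: "blinfun_apply (DT \<zeta>) (a, gh y, (2 * (- \<alpha> * E)) *\<^sub>R I) \<le> E * \<alpha> * (C * B)"
      by (simp add: mult_ac)
    have "blinfun_apply (DT \<zeta>) (0, 0, outer (y - z)) \<le> - \<theta> * ((y - z) \<bullet> (y - z))" by (rule \<theta>(2)[OF \<zeta>])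
    also have "\<dots> \<le> - \<theta> * (\<rho> / 2)\<^sup>2"
      using \<theta> y \<rho> by (auto simp: power2_norm_eq_inner[symmetric] intro!: power_mono)
    finally have "(4 * (\<alpha>\<^sup>2 * E)) * blinfun_apply (DT \<zeta>) (0, 0, outer (y - z)) \<le> (4 * (\<alpha>\<^sup>2 * E)) * (- \<theta> * (\<rho> / 2)\<^sup>2)"
      using E by (intro mult_left_mono) auto
    also have "\<dots> = - (E * \<alpha> * (\<alpha> * (\<theta> * \<rho>\<^sup>2)))" by (simp add: power2_eq_square)
    finally have 2: "(4 * (\<alpha>\<^sup>2 * E)) * blinfun_apply (DT \<zeta>) (0, 0, outer (y - z)) \<le> - (E * \<alpha> * (\<alpha> * (\<theta> * \<rho>\<^sup>2)))" .
    have "E * \<alpha> * (C * B) < E * \<alpha> * (\<alpha> * (\<theta> * \<rho>\<^sup>2))"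
      using E \<alpha>1 \<alpha>2 by (intro mult_strict_left_mono) auto
    with 1 2 show ?thesis unfolding split blinfun.add_right blinfun.scaleR_right by simp
  qed
  \<comment> \<open>On the part of the small sphere inside the ball \<open>U - V\<close> has a positive minimum, which limits \<open>\<kappa>\<close>; outside
     the ball the barrier is negative.\<close>
  define S1 where "S1 = sphere y1 s \<inter> cball z \<rho>"
  obtain \<kappa> where \<kappa>: "\<kappa> > 0" "\<And>y. y \<in> S1 \<Longrightarrow> \<kappa> \<le> U y - V y"
  proof (cases "S1 = {}")
    case True then show ?thesis using that[of 1] by auto
  next
    case False
    have sub: "S1 \<subseteq> \<Omega>" using s(3) by (auto simp: S1_def)
    have "compact S1" by (auto simp: S1_def intro: compact_Int)
    then obtain y where y: "y \<in> S1" "\<And>y'. y' \<in> S1 \<Longrightarrow> U y - V y \<le> U y' - V y'"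
      using continuous_attains_inf[of S1 "\<lambda>y. U y - V y"] False continuous_on_subset[OF Uc sub]
        continuous_on_subset[OF Vc sub] by (auto intro: continuous_on_diff)
    then have "U y - V y > 0" using strict[of y] sub s by (auto simp: S1_def)
    then show ?thesis using that y by blast
  qed
  define W where "W = (\<lambda>y. U y - V y - \<kappa> * h y)"
  have h_y1: "h y1 = 0" using \<rho> by (simp add: h_def F_def dist_norm norm_minus_commute power2_norm_eq_inner[symmetric])
  have W_sphere: "W y \<ge> 0" if y: "y \<in> sphere y1 s" for y
  proof (cases "y \<in> cball z \<rho>")
    case True
    have "h y \<le> 1"
    proof -
      have "exp (- \<alpha> * ((y - z) \<bullet> (y - z))) \<le> 1" using \<alpha>1 by simp
      then show ?thesis unfolding h_def F_def by (smt (verit) exp_gt_zero)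
    qed
    then have "\<kappa> * h y \<le> \<kappa>" using \<kappa>(1) by simp
    then show ?thesis using \<kappa>(2)[of y] y True by (simp add: W_def S1_def)
  next
    case False
    then have "\<rho>\<^sup>2 < (y - z) \<bullet> (y - z)"
      using \<rho> unfolding power2_norm_eq_inner[symmetric]
      by (intro power_strict_mono) (auto simp: dist_norm norm_minus_commute)
    then have "h y < 0" using \<alpha>1 by (simp add: h_def F_def)
    then show ?thesis using \<kappa> UV[of y] s(3) y by (auto simp: W_def) (smt (verit) mult_pos_neg sphere_cball subsetD mem_sphere y)
  qed
  obtain ym where ym: "ym \<in> ball y1 s" "\<And>y. y \<in> cball y1 s \<Longrightarrow> W ym \<le> W y"
  proof -
    have "continuous_on (cball y1 s) W"
      unfolding W_def by (intro continuous_intros hc continuous_on_subset[OF Uc s(3)] continuous_on_subset[OF Vc s(3)])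
    then obtain y where y: "y \<in> cball y1 s" "\<And>y'. y' \<in> cball y1 s \<Longrightarrow> W y \<le> W y'"
      using continuous_attains_inf[of "cball y1 s" W] s by auto
    show ?thesis
    proof (cases "y \<in> ball y1 s")
      case True then show ?thesis using that y by blast
    next
      case False
      then have "W y \<ge> 0" using y by (intro W_sphere) auto
      moreover have "W y1 = 0" by (simp add: W_def y1 h_y1)
      ultimately show ?thesis using that[of y1] y(2) s by fastforce
    qed
  qed
  have ym\<Omega>: "ym \<in> \<Omega>" using ym(1) s(3) by auto
  have Wjet: "has_2jet W (\<lambda>y. gU y - gV y - \<kappa> *\<^sub>R gh y) (HU ym - HV ym - \<kappa> *\<^sub>R Hh ym) ym"
    unfolding W_def by (intro has_2jet_minus has_2jet_scale U(1) V(1) hjet ym\<Omega>)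
  define P where "P = HU ym - HV ym - \<kappa> *\<^sub>R Hh ym"
  note min = has_2jet_local_min[OF Wjet open_ball ym(1) ym(2)]
  have grad: "gU ym - gV ym = \<kappa> *\<^sub>R gh ym" using min(1) by auto
  have P: "positive_semidefinite P"
    unfolding positive_semidefinite_def P_def using min(2) has_2jet_symmetric[OF Wjet] by auto
  \<comment> \<open>At the minimum \<open>U - V\<close> may be smaller than \<open>\<kappa> h\<close>; the rescaled value \<open>a\<close> replaces \<open>h ym\<close> in the jet of
     the barrier, and only \<open>0 \<le> a \<le> h ym\<close> matters.\<close>
  define a where "a = (U ym - V ym) / \<kappa>"
  have a: "0 \<le> a" "a \<le> h ym"
  proof -
    show "0 \<le> a" using UV[OF ym\<Omega>] \<kappa> by (simp add: a_def)
    have "W ym \<le> 0" using ym(2)[of y1] s h_y1 y1 by (simp add: W_def)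
    then show "a \<le> h ym" using \<kappa> by (simp add: W_def a_def field_simps)
  qed
  define d where "d = (U ym - V ym, gU ym - gV ym, HU ym - HV ym)"
  have Jt: "J (ym, t) = J (ym, 0) + t *\<^sub>R d" for t by (simp add: J_def d_def)
  define G where "G = (\<lambda>t. (\<lambda>(s, p, M). T s p M) (J (ym, t)))"
  have G: "(G has_derivative (\<lambda>r. blinfun_apply (DT (J (ym, t))) (r *\<^sub>R d))) (at t within {0..1})"
    if "t \<in> {0..1}" for t
  proof -
    have L: "((\<lambda>t. J (ym, t)) has_derivative (\<lambda>r. r *\<^sub>R d)) (at t within {0..1})"
    proof -
      have "((\<lambda>t. J (ym, 0) + t *\<^sub>R d) has_derivative (\<lambda>r. r *\<^sub>R d)) (at t within {0..1})"
        by (auto intro!: derivative_eq_intros)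
      then show ?thesis by (simp only: Jt[symmetric])
    qed
    have dom: "J (ym, r) \<in> ?dom" if "r \<in> {0..1}" for r using J_dom[OF ym\<Omega>] that by simp
    have "((\<lambda>(s, p, M). T s p M) has_derivative blinfun_apply (DT (J (ym, t))))
        (at (J (ym, t)) within (\<lambda>t. J (ym, t)) ` {0..1})"
      using dom by (intro has_derivative_subset[OF DTd[OF dom[OF that]]]) blast
    from has_derivative_in_compose[OF L this] show ?thesis unfolding G_def .
  qed
  obtain t where t: "t \<in> {0<..<1}" "G 1 - G 0 = blinfun_apply (DT (J (ym, t))) ((1 - 0) *\<^sub>R d)"
    using mvt_simple[of 0 1 G "\<lambda>t r. blinfun_apply (DT (J (ym, t))) (r *\<^sub>R d)"] G by auto
  have "G 1 \<ge> 0" "G 0 \<le> 0" using T_U[OF ym\<Omega>] T_V[OF ym\<Omega>] by (simp_all add: G_def J_def)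
  then have nonneg: "blinfun_apply (DT (J (ym, t))) d \<ge> 0" using t(2) by simp
  have tZ: "J (ym, t) \<in> Z" unfolding Z_def using t(1) ym(1) by (intro imageI) auto
  have "d = \<kappa> *\<^sub>R (a, gh ym, Hh ym) + (0, 0, P)"
    using \<kappa> by (simp add: d_def grad a_def P_def)
  then have "blinfun_apply (DT (J (ym, t))) d
      = \<kappa> * blinfun_apply (DT (J (ym, t))) (a, gh ym, Hh ym) + blinfun_apply (DT (J (ym, t))) (0, 0, P)"
    by (simp only: blinfun.add_right blinfun.scaleR_right real_scaleR_def)
  moreover have "blinfun_apply (DT (J (ym, t))) (0, 0, P) \<le> 0"
  proof -
    let ?L = "\<lambda>N. - blinfun_apply (DT (J (ym, t))) (0, 0, N)"
    have "linear ?L"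
    proof (rule linearI)
      show "?L (N + N') = ?L N + ?L N'" for N N'
        using blinfun.add_right[of "DT (J (ym, t))" "(0, 0, N)" "(0, 0, N')"] by simp
      show "?L (c *\<^sub>R N) = c *\<^sub>R ?L N" for c N
        using blinfun.scaleR_right[of "DT (J (ym, t))" c "(0, 0, N)"] by simp
    qed
    moreover have "?L (outer x) \<ge> 0" for x
    proof -
      have "- \<theta> * (x \<bullet> x) \<le> 0" using \<theta>(1) by simp
      then show ?thesis using \<theta>(2)[OF tZ, of x] by linarith
    qed
    ultimately have "?L P \<ge> 0" using positive_semidefinite_form_nonneg P by blast
    then show ?thesis by simp
  qed
  moreover have "blinfun_apply (DT (J (ym, t))) (a, gh ym, Hh ym) < 0"
  proof (rule barrier[OF tZ _ _ a])
    have "dist ym y1 \<le> \<rho> / 2" using ym(1) s(2) by (simp add: dist_commute)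
    then show "\<rho> / 2 \<le> norm (ym - z)" "norm (ym - z) \<le> 2 * \<rho>"
      using \<rho> dist_triangle[of z y1 ym] dist_triangle[of ym z y1]
      by (auto simp: dist_norm[symmetric] dist_commute)
  qed
  ultimately show False using nonneg \<kappa>(1) by (smt (verit) mult_pos_neg)
qed

text \<open>
  If the contact set were neither empty nor everything, it would have a boundary point in the connected set
  \<open>\<Omega>\<close>. From a point \<open>q\<close> outside the contact set but close to that boundary point a ball can be inflated
  until it meets the contact set. The ball over half the radius towards a nearest contact point \<open>y1\<close>
  meets the contact set in \<open>y1\<close> alone, which is the situation excluded by Hopf's argument.
\<close>

lemma strong_comparison_principle:
  fixes T :: "real \<Rightarrow> real^'n \<Rightarrow> real^'n^'n \<Rightarrow> real"
  assumes DT: "elliptic_derivative T DT"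
    and \<Omega>: "open \<Omega>" "connected \<Omega>"
    and U: "\<And>x. x \<in> \<Omega> \<Longrightarrow> has_2jet U gU (HU x) x" "continuous_on \<Omega> gU" "continuous_on \<Omega> HU"
    and V: "\<And>x. x \<in> \<Omega> \<Longrightarrow> has_2jet V gV (HV x) x" "continuous_on \<Omega> gV" "continuous_on \<Omega> HV"
    and V_pos: "\<And>x. x \<in> \<Omega> \<Longrightarrow> V x > 0" and UV: "\<And>x. x \<in> \<Omega> \<Longrightarrow> U x \<ge> V x"
    and T_U: "\<And>x. x \<in> \<Omega> \<Longrightarrow> T (U x) (gU x) (HU x) \<ge> 0"
    and T_V: "\<And>x. x \<in> \<Omega> \<Longrightarrow> T (V x) (gV x) (HV x) \<le> 0"
    and x0: "x0 \<in> \<Omega>" "U x0 = V x0" and x: "x \<in> \<Omega>"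
  shows "U x = V x"
proof (rule ccontr)
  assume ne: "U x \<noteq> V x"
  have Uc: "continuous_on \<Omega> U" and Vc: "continuous_on \<Omega> V"
    using has_2jet_isCont[OF U(1)] has_2jet_isCont[OF V(1)] continuous_at_imp_continuous_on by blast+
  define Z where "Z = {y \<in> \<Omega>. U y = V y}"
  have "open {y \<in> \<Omega>. U y - V y \<noteq> 0}"
    using continuous_open_preimage[of \<Omega> "\<lambda>y. U y - V y" "- {0}"] \<Omega> Uc Vc
    by (auto simp: vimage_def Int_def intro: continuous_on_diff)
  moreover have "{y \<in> \<Omega>. U y - V y \<noteq> 0} = \<Omega> - Z" by (auto simp: Z_def)
  ultimately have "open (\<Omega> - Z)" by simp
  then have "\<not> open Z"
    using connectedD[OF \<Omega>(2), of Z "\<Omega> - Z"] x0 x ne by (auto simp: Z_def)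
  then obtain z1 where z1: "z1 \<in> Z" "\<And>e. e > 0 \<Longrightarrow> \<not> ball z1 e \<subseteq> Z"
    unfolding open_contains_ball by blast
  obtain R0 where R0: "R0 > 0" "cball z1 R0 \<subseteq> \<Omega>" using z1 \<Omega> open_contains_cball by (metis (no_types, lifting) Z_def mem_Collect_eq)
  define R where "R = R0 / 2"
  have R: "R > 0" "cball z1 (2 * R) \<subseteq> \<Omega>" using R0 by (auto simp: R_def)
  obtain q where q: "q \<in> ball z1 R" "q \<notin> Z" using z1(2)[OF R(1)] by blast
  define K where "K = {y \<in> cball z1 (2 * R). U y - V y = 0}"
  have KZ: "K = Z \<inter> cball z1 (2 * R)" using R(2) by (auto simp: K_def Z_def)
  have "closed K"
    unfolding K_def using continuous_on_subset[OF Uc R(2)] continuous_on_subset[OF Vc R(2)]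
    by (intro continuous_closed_preimage_constant continuous_on_diff) auto
  moreover have "K = K \<inter> cball z1 (2 * R)" by (auto simp: K_def)
  ultimately have "compact K" using closed_Int_compact[of K "cball z1 (2 * R)"] by simp
  moreover have "z1 \<in> K" using z1 R by (auto simp: KZ)
  ultimately obtain y1 where y1: "y1 \<in> K" "\<And>y. y \<in> K \<Longrightarrow> dist q y1 \<le> dist q y"
    using distance_attains_inf[of K q] compact_imp_closed by blast
  define \<rho> where "\<rho> = dist q y1 / 2"
  have "q \<noteq> y1" using q y1 KZ by auto
  then have \<rho>: "\<rho> > 0" by (simp add: \<rho>_def)
  have \<rho>R: "2 * \<rho> < R" using y1(2)[OF \<open>z1 \<in> K\<close>] q(1) by (simp add: \<rho>_def dist_commute)
  define z where "z = (1/2) *\<^sub>R (q + y1)"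
  have qz: "q - z = (1/2) *\<^sub>R (q - y1)" and y1z: "y1 - z = - (q - z)"
    by (simp_all add: z_def algebra_simps flip: scaleR_left_distrib)
  have nqz: "norm (q - z) = \<rho>" by (simp add: qz \<rho>_def dist_norm)
  show False
  proof (rule no_touching_at_interior_sphere_point[OF DT \<Omega>(1) U V V_pos UV T_U T_V \<rho>])
    show "dist z y1 = \<rho>" using y1z nqz by (metis dist_norm norm_minus_cancel norm_minus_commute)
    show "y1 \<in> \<Omega>" "U y1 = V y1" using y1(1) by (auto simp: KZ Z_def)
    fix y assume y: "y \<in> cball z \<rho> \<inter> \<Omega>" "y \<noteq> y1"
    have yz: "norm (y - z) \<le> \<rho>" using y by (simp add: dist_norm norm_minus_commute)
    have "dist q y < 2 * \<rho>"
    proof (rule ccontr)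
      assume "\<not> ?thesis"
      then have "(2 * \<rho>)\<^sup>2 \<le> (norm ((q - z) - (y - z)))\<^sup>2"
        using \<rho> by (intro power_mono) (auto simp: dist_norm)
      moreover have parallelogram: "(norm (a + b))\<^sup>2 + (norm (a - b))\<^sup>2 = 2 * (norm a)\<^sup>2 + 2 * (norm b)\<^sup>2"
        for a b :: "real^'n"
        unfolding power2_norm_eq_inner by (simp add: inner_add_left inner_add_right inner_diff_left inner_diff_right)
      moreover have "(norm (y - z))\<^sup>2 \<le> \<rho>\<^sup>2" "(norm (q - z))\<^sup>2 = \<rho>\<^sup>2" "(2 * \<rho>)\<^sup>2 = 4 * \<rho>\<^sup>2"
        using yz nqz by (auto intro: power_mono simp: power_mult_distrib)
      ultimately have "(norm ((q - z) + (y - z)))\<^sup>2 \<le> 0"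
        using parallelogram[of "q - z" "y - z"] by linarith
      then have "(q - z) + (y - z) = 0" by simp
      then have "y - z = y1 - z" using y1z by (metis add.commute add_eq_0_iff)
      then show False using y(2) by simp
    qed
    then have "y \<notin> K" using y1(2)[of y] by (auto simp: \<rho>_def)
    moreover have "y \<in> cball z1 (2 * R)"
      using \<open>dist q y < 2 * \<rho>\<close> \<rho>R q(1) dist_triangle[of z1 y q] by (auto simp: dist_commute)
    ultimately have "U y \<noteq> V y" by (auto simp: K_def)
    then show "U y > V y" using UV[of y] y(1) by auto
  qed auto
qed

section \<open>Sliding a family of subsolutions below a supersolution\<close>

text \<open>
  The tube lemma, with the openness of the condition tested point by point.
\<close>

lemma uniform_on_compact:
  fixes p :: "'a::metric_space" and K :: "'b::metric_space set"
  assumes K: "compact K"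
    and loc: "\<And>y. y \<in> K \<Longrightarrow> \<forall>\<^sub>F q in nhds (p, y). snd q \<in> K \<longrightarrow> P (fst q) (snd q)"
  shows "\<exists>e>0. \<forall>l. dist l p < e \<longrightarrow> (\<forall>y\<in>K. P l y)"
proof -
  define O' where "O' = interior {q. snd q \<in> K \<longrightarrow> P (fst q) (snd q)}"
  have "{p} \<times> K \<subseteq> O'"
  proof clarify
    fix y assume "y \<in> K"
    from loc[OF this] show "(p, y) \<in> O'"
      unfolding O'_def eventually_nhds interior_def by auto
  qed
  then obtain X where X: "p \<in> X" "open X" "X \<times> K \<subseteq> O'"
    using Elementary_Topology.tube_lemma[OF K, of O' p] by (auto simp: O'_def)
  then obtain e where e: "e > 0" "\<And>l. dist l p < e \<Longrightarrow> l \<in> X"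
    unfolding open_dist by blast
  have "P l y" if "dist l p < e" "y \<in> K" for l y
  proof -
    have "(l, y) \<in> O'" using X(3) e(2)[OF that(1)] that(2) by blast
    then show ?thesis using interior_subset that(2) by (force simp: O'_def)
  qed
  then show ?thesis using e(1) by blast
qed

lemma isCont_tendsto_nhds: "isCont f x \<Longrightarrow> (f \<longlongrightarrow> f x) (nhds x)"
  using tendsto_at_iff_tendsto_nhds[of f x] by (simp add: isCont_def)

text \<open>
  The set of parameters for which \<open>W l\<close> lies below \<open>U\<close> is closed. It is also open to the right before
  \<open>l1\<close>: the strong comparison principle makes the inequality strict off the origin, since equality
  everywhere would propagate to the sphere; near the origin there is room because \<open>W l 0\<close> is below \<open>\<alpha>\<close>
  while \<open>U\<close> stays essentially above \<open>\<alpha>\<close>. Compactness of the ball then gives a uniform margin.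
\<close>

lemma sliding_method:
  fixes T :: "real \<Rightarrow> real^'n \<Rightarrow> real^'n^'n \<Rightarrow> real" and W :: "real \<Rightarrow> real^'n \<Rightarrow> real"
  assumes DT: "elliptic_derivative T DT" and n: "CARD('n) \<ge> 2" and r: "0 < r" "r < R" and l01: "l0 \<le> l1"
    and U: "\<And>x. x \<in> ball 0 R - {0} \<Longrightarrow> has_2jet U gU (HU x) x"
      "continuous_on (ball 0 R - {0}) gU" "continuous_on (ball 0 R - {0}) HU"
    and T_U: "\<And>x. x \<in> ball 0 R - {0} \<Longrightarrow> T (U x) (gU x) (HU x) \<ge> 0"
    and W: "\<And>l x. l \<in> {l0..l1} \<Longrightarrow> x \<in> ball 0 R \<Longrightarrow> has_2jet (W l) (gW l) (HW l x) x"
      "\<And>l. l \<in> {l0..l1} \<Longrightarrow> continuous_on (ball 0 R) (gW l)"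
      "\<And>l. l \<in> {l0..l1} \<Longrightarrow> continuous_on (ball 0 R) (HW l)"
    and W_pos: "\<And>l x. l \<in> {l0..l1} \<Longrightarrow> x \<in> ball 0 R \<Longrightarrow> W l x > 0"
    and T_W: "\<And>l x. l \<in> {l0..l1} \<Longrightarrow> x \<in> ball 0 R \<Longrightarrow> T (W l x) (gW l x) (HW l x) \<le> 0"
    and W_cont: "\<And>l x. l \<in> {l0..l1} \<Longrightarrow> x \<in> ball 0 R \<Longrightarrow> isCont (\<lambda>q. W (fst q) (snd q)) (l, x)"
    and boundary: "\<And>l y. l \<in> {l0..l1} \<Longrightarrow> norm y = r \<Longrightarrow> W l y < U y"
    and start: "\<And>y. y \<in> cball 0 r - {0} \<Longrightarrow> W l0 y \<le> U y"
    and origin: "\<And>l. l \<in> {l0..<l1} \<Longrightarrow> W l 0 < \<alpha>"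
    and U_near_0: "\<And>\<beta>. \<beta> < \<alpha> \<Longrightarrow> \<forall>\<^sub>F y in at 0. U y > \<beta>"
  shows "\<And>y. y \<in> cball 0 r - {0} \<Longrightarrow> W l1 y \<le> U y"
proof -
  define S where "S = {l \<in> {l0..l1}. \<forall>y \<in> cball 0 r - {0}. W l y \<le> U y}"
  have l0S: "l0 \<in> S" using l01 start by (simp add: S_def)
  have bdd: "bdd_above S" by (auto simp: S_def bdd_above_def)
  define L where "L = Sup S"
  have "l0 \<le> L" unfolding L_def by (rule cSup_upper[OF l0S bdd])
  moreover have "L \<le> l1"
    unfolding L_def using l0S by (intro cSup_least) (auto simp: S_def)
  ultimately have L: "l0 \<le> L" "L \<le> l1" by auto
  have LS: "L \<in> S"
  proof -
    have "W L y \<le> U y" if y: "y \<in> cball 0 r - {0}" for y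
    proof (rule ccontr)
      assume gt: "\<not> ?thesis"
      have "isCont (\<lambda>l. W l y) L"
        using isCont_o2[of L "\<lambda>l. (l, y)" "\<lambda>q. W (fst q) (snd q)"] W_cont[of L y] L y r by simp
      from order_tendstoD(1)[OF isCont_tendsto_nhds[OF this], of "U y"] gt
      have "\<forall>\<^sub>F l in nhds L. W l y > U y" by simp
      then obtain e where e: "e > 0" "\<And>l. dist l L < e \<Longrightarrow> W l y > U y"
        unfolding eventually_nhds_metric by blast
      obtain l where l: "l \<in> S" "L - e < l" using less_cSupD[of S "L - e"] l0S e(1) by (auto simp: L_def)
      then have "l \<le> L" using cSup_upper[OF l(1) bdd] by (simp add: L_def)
      then have "W l y > U y" using l e(2)[of l] by (simp add: dist_real_def)
      then show False using l(1) y by (force simp: S_def)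
    qed
    then show ?thesis using L by (simp add: S_def)
  qed
  have le: "W L y \<le> U y" if "y \<in> cball 0 r - {0}" for y using LS that by (simp add: S_def)
  have "L = l1"
  proof (rule ccontr)
    assume "L \<noteq> l1"
    then have Ll: "L < l1" using L by simp
    have LI: "L \<in> {l0..l1}" using L by simp
    let ?\<Omega> = "ball (0::real^'n) r - {0}"
    have \<Omega>: "open ?\<Omega>" "connected ?\<Omega>"
      using n connected_open_delete[of "ball 0 r :: (real^'n) set" 0] by (auto intro: open_delete)
    have sub: "?\<Omega> \<subseteq> ball 0 R - {0}" "?\<Omega> \<subseteq> ball 0 R" using r by auto
    have strict: "W L y < U y" if y: "y \<in> cball 0 r - {0}" for y
    proof (rule ccontr)
      assume "\<not> ?thesis"
      then have eq: "U y = W L y" using le[OF y] by simp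
      then have "norm y \<noteq> r" using boundary[OF LI, of y] by auto
      then have y\<Omega>: "y \<in> ?\<Omega>" using y by auto
      have all: "U x = W L x" if "x \<in> ?\<Omega>" for x
        by (rule strong_comparison_principle[OF DT \<Omega> U(1) continuous_on_subset[OF U(2) sub(1)]
              continuous_on_subset[OF U(3) sub(1)] W(1)[OF LI] continuous_on_subset[OF W(2)[OF LI] sub(2)]
              continuous_on_subset[OF W(3)[OF LI] sub(2)] W_pos[OF LI] _ T_U T_W[OF LI] y\<Omega> eq that])
          (use sub le in \<open>auto simp: subset_iff\<close>)
      \<comment> \<open>Equality on the open punctured ball is carried to a point of the sphere along its radius.\<close>
      define b where "b = (r / norm y) *\<^sub>R y"
      have b: "norm b = r" using y r by (simp add: b_def)
      have bR: "b \<in> ball 0 R - {0}" using b r by auto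
      have line: "isCont (\<lambda>t. t *\<^sub>R b) 1" by (intro continuous_intros)
      have "isCont U (1 *\<^sub>R b)" "isCont (W L) (1 *\<^sub>R b)"
        using has_2jet_isCont[OF U(1)[OF bR]] has_2jet_isCont[OF W(1)[OF LI, of b]] bR by simp_all
      from isCont_diff[OF isCont_o2[OF line this(1)] isCont_o2[OF line this(2)]]
      have "((\<lambda>t. U (t *\<^sub>R b) - W L (t *\<^sub>R b)) \<longlongrightarrow> U (1 *\<^sub>R b) - W L (1 *\<^sub>R b)) (at_left 1)"
        unfolding isCont_def by (rule filterlim_mono) (auto simp: at_le)
      then have lim: "((\<lambda>t. U (t *\<^sub>R b) - W L (t *\<^sub>R b)) \<longlongrightarrow> U b - W L b) (at_left 1)" by simp
      have "\<forall>\<^sub>F t in at_left 1. U (t *\<^sub>R b) - W L (t *\<^sub>R b) = 0"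
      proof (rule eventually_mono[OF eventually_at_left_real[of 0 1]])
        fix t :: real assume t: "t \<in> {0<..<1}"
        then have "norm (t *\<^sub>R b) < r" using b r by simp
        then have "t *\<^sub>R b \<in> ?\<Omega>" using t b r by auto
        from all[OF this] show "U (t *\<^sub>R b) - W L (t *\<^sub>R b) = 0" by simp
      qed simp
      from tendsto_eventually[OF this] lim have "U b - W L b = 0"
        by (intro tendsto_unique[OF trivial_limit_at_left_real])
      then show False using boundary[OF LI b] by simp
    qed
    have "\<exists>e>0. \<forall>l. dist l L < e \<longrightarrow> (\<forall>y\<in>cball 0 r. l \<in> {l0..l1} \<and> y \<noteq> 0 \<longrightarrow> W l y < U y)"
    proof (rule uniform_on_compact[OF compact_cball])
      fix y :: "real^'n" assume y: "y \<in> cball 0 r"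
      have yR: "y \<in> ball 0 R" using y r by auto
      have Wt: "((\<lambda>q. W (fst q) (snd q)) \<longlongrightarrow> W L y) (nhds (L, y))"
        using isCont_tendsto_nhds[OF W_cont[OF LI yR]] by simp
      have "\<forall>\<^sub>F q in nhds (L, y). snd q \<noteq> 0 \<longrightarrow> W (fst q) (snd q) < U (snd q)"
      proof (cases "y = 0")
        case True
        define \<beta> where "\<beta> = (W L 0 + \<alpha>) / 2"
        have \<beta>: "W L 0 < \<beta>" "\<beta> < \<alpha>" using origin[of L] L Ll by (auto simp: \<beta>_def)
        have "\<forall>\<^sub>F y in nhds 0. y \<noteq> 0 \<longrightarrow> U y > \<beta>"
          using U_near_0[OF \<beta>(2)] by (simp add: eventually_at_filter)
        then have "\<forall>\<^sub>F q in nhds (L, y). snd q \<noteq> 0 \<longrightarrow> U (snd q) > \<beta>"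
          using True filterlim_iff[of snd "nhds y" "nhds (L, y)"] tendsto_snd[OF filterlim_ident, of "(L, y)"]
          by auto
        moreover have "\<forall>\<^sub>F q in nhds (L, y). W (fst q) (snd q) < \<beta>"
          using order_tendstoD(2)[OF Wt] \<beta>(1) True by simp
        ultimately show ?thesis by eventually_elim auto
      next
        case False
        have "isCont U y" using has_2jet_isCont[OF U(1)] yR False by auto
        then have "((\<lambda>q. U (snd q)) \<longlongrightarrow> U y) (nhds (L, y))"
          using isCont_tendsto_compose[of y U snd "nhds (L, y)"] tendsto_snd[OF filterlim_ident, of "(L, y)"] by simp
        from tendsto_diff[OF this Wt] have "\<forall>\<^sub>F q in nhds (L, y). U (snd q) - W (fst q) (snd q) > 0"
          by (rule order_tendstoD(1)) (use strict y False in auto)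
        then show ?thesis by eventually_elim auto
      qed
      then show "\<forall>\<^sub>F q in nhds (L, y). snd q \<in> cball 0 r \<longrightarrow>
          (fst q \<in> {l0..l1} \<and> snd q \<noteq> 0 \<longrightarrow> W (fst q) (snd q) < U (snd q))"
        by eventually_elim auto
    qed
    then obtain e where e: "e > 0"
      "\<And>l y. dist l L < e \<Longrightarrow> y \<in> cball 0 r \<Longrightarrow> l \<in> {l0..l1} \<Longrightarrow> y \<noteq> 0 \<Longrightarrow> W l y < U y" by blast
    define l where "l = min l1 (L + e / 2)"
    have l: "L < l" "l \<in> {l0..l1}" "dist l L < e" using L Ll e(1) by (auto simp: l_def dist_real_def)
    then have "l \<in> S" using e(2)[of l] by (force simp: S_def less_imp_le)
    then show False using cSup_upper[OF _ bdd, of l] l(1) by (simp add: L_def)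
  qed
  then show "W l1 y \<le> U y" if "y \<in> cball 0 r - {0}" for y using le[OF that] by simp
qed

text \<open>
  Each value \<open>d \<bullet> (H *v d)\<close> is a limit of difference quotients of the gradient along \<open>d\<close>, paired with
  \<open>d\<close>, and these are nonnegative for the monotone gradient of a convex function.
\<close>

lemma monotone_gradient_trace_nonneg:
  assumes J: "has_2jet f g H x"
    and mono: "\<forall>\<^sub>F y in nhds x. (g y - g x) \<bullet> (y - x) \<ge> 0"
  shows "trace H \<ge> 0"
proof (rule trace_nonnegI)
  fix d
  show "d \<bullet> (H *v d) \<ge> 0"
  proof (rule ccontr)
    assume neg: "\<not> ?thesis"
    from DERIV_neg_dec_right[OF has_2jet_second_derivative_along_line[OF J], of d] neg obtain d1 where d1: "d1 > 0"
      "\<And>h. h > 0 \<Longrightarrow> h < d1 \<Longrightarrow> g (x + h *\<^sub>R d) \<bullet> d < g x \<bullet> d" by auto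
    obtain e where e: "e > 0" "\<And>y. dist y x < e \<Longrightarrow> (g y - g x) \<bullet> (y - x) \<ge> 0"
      using mono unfolding eventually_nhds_metric by blast
    define q where "q = e / (norm d + 1)"
    define h where "h = min d1 q / 2"
    have nd: "norm d + 1 > 0" by (simp add: add_nonneg_pos)
    have "q > 0" using e(1) nd by (simp add: q_def)
    then have h: "h > 0" "h < d1" "h < e / (norm d + 1)"
      using d1(1) unfolding h_def q_def[symmetric] by auto
    have "h * norm d \<le> h * (norm d + 1)" using h(1) by simp
    also have "\<dots> < e" using h(3) nd by (simp add: pos_less_divide_eq)
    finally have "dist (x + h *\<^sub>R d) x < e" using h(1) by (simp add: dist_norm)
    from e(2)[OF this] have "h * ((g (x + h *\<^sub>R d) - g x) \<bullet> d) \<ge> 0" by simp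
    moreover have "(g (x + h *\<^sub>R d) - g x) \<bullet> d < 0" using d1(2)[OF h(1,2)] by (simp add: inner_diff_left)
    ultimately show False using h(1) by (simp add: zero_le_mult_iff)
  qed
qed

lemma C1_differentiable_on_real:
  fixes f :: "real \<Rightarrow> real"
  assumes "f C1_differentiable_on S" "open S"
  shows "\<And>x. x \<in> S \<Longrightarrow> (f has_real_derivative deriv f x) (at x)"
    and "continuous_on S (deriv f)"
proof -
  obtain D where D: "\<And>x. x \<in> S \<Longrightarrow> (f has_vector_derivative D x) (at x)" "continuous_on S D"
    using assms(1) unfolding C1_differentiable_on_def by blast
  have *: "(f has_real_derivative D x) (at x)" if "x \<in> S" for x
    using D(1)[OF that] by (simp add: has_real_derivative_iff_has_vector_derivative)
  then have eq: "deriv f x = D x" if "x \<in> S" for x using that DERIV_imp_deriv by blast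
  then show "continuous_on S (deriv f)" using D(2) by (simp cong: continuous_on_cong)
  show "(f has_real_derivative deriv f x) (at x)" if "x \<in> S" for x using * eq that by simp
qed

section \<open>Positive distance at an isolated singularity\<close>

theorem corollary1p7:
  fixes T :: "real \<Rightarrow> real^'n \<Rightarrow> real^'n^'n \<Rightarrow> real"
    and u v :: "real^'n \<Rightarrow> real"
    and \<phi> \<xi> \<psi> :: "real \<Rightarrow> real"
    and \<delta> \<epsilon> :: real
  assumes n: "CARD('n) \<ge> 2"
    and T_C1: "C1_on (\<lambda>(s, p, M). T s p M) ({0<..} \<times> UNIV \<times> symmetric_matrices)"
    and T_elliptic: "\<And>s p M. s > 0 \<Longrightarrow> M \<in> symmetric_matrices \<Longrightarrow>
          positive_definite (- matrix_partials (T s p) M)"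
    and u_C2: "C2_on u (ball 0 2 - {0})"
    and v_C2: "C2_on v (ball 0 2)"
    and v_pos: "\<And>x. x \<in> ball 0 2 \<Longrightarrow> v x > 0"
    and u_gt_v: "\<And>x. x \<in> ball 0 2 - {0} \<Longrightarrow> u x > v x"
    and u_superharmonic: "\<And>x. x \<in> ball 0 2 - {0} \<Longrightarrow> laplacian u x \<le> 0"
    and T_u: "\<And>x. x \<in> ball 0 2 - {0} \<Longrightarrow> T (u x) (grad u x) (hessian u x) \<ge> 0"
    and T_v: "\<And>x. x \<in> ball 0 2 - {0} \<Longrightarrow> 0 \<ge> T (v x) (grad v x) (hessian v x)"
    and \<delta>: "\<delta> > 0"
    and C1_near_1: "\<phi> C1_differentiable_on ball 1 \<delta>"
          "\<xi> C1_differentiable_on ball 1 \<delta>"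
          "\<psi> C1_differentiable_on ball 1 \<delta>"
    and at_1: "\<phi> 1 = 1" "\<xi> 1 = 1" "\<psi> 1 = 0"
    and \<phi>_mono: "\<And>l. l \<in> ball 1 \<delta> \<Longrightarrow> deriv \<phi> l \<ge> 0"
    and \<psi>_mono: "\<And>l. l \<in> ball 1 \<delta> \<Longrightarrow> deriv \<psi> l \<ge> 0"
    and \<phi>_\<psi>_pos: "\<And>l. l \<in> ball 1 \<delta> \<Longrightarrow> deriv \<phi> l + deriv \<psi> l > 0"
    and \<phi>_\<xi>: "\<And>l. l \<in> ball 1 \<delta> \<Longrightarrow> deriv \<phi> l * \<xi> l + \<phi> l * deriv \<xi> l \<ge> 0"
    and \<epsilon>: "\<epsilon> > 0"
    and T_Phi: "\<And>l y. \<bar>l - 1\<bar> < \<epsilon> \<Longrightarrow> y \<in> ball 0 \<epsilon> \<Longrightarrow>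
          T (Phi \<phi> \<xi> \<psi> v 0 l y) (grad (Phi \<phi> \<xi> \<psi> v 0 l) y) (hessian (Phi \<phi> \<xi> \<psi> v 0 l) y) \<le> 0"
  shows "Liminf (at 0) (\<lambda>x. ereal (u x - v x)) > 0"
proof -
  obtain DT where DT: "elliptic_derivative T DT"
    using elliptic_derivative_exists[OF T_C1 T_elliptic] by blast
  have ou: "open (ball (0::real^'n) 2 - {0})" by (intro open_delete open_ball)
  note u = C2_onD[OF ou u_C2] and v = C2_onD[OF open_ball v_C2]
  have tr_u: "trace (hessian u x) \<le> 0" if "x \<in> ball 0 2 - {0}" for x
    using u_superharmonic[OF that] by (simp add: laplacian_def trace_def)
  have v0: "v 0 > 0" by (rule v_pos) simp
  have v_cont: "isCont v x" if "norm x < 2" for x using has_2jet_isCont[OF v(4)] that by simp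
  have gv_cont: "isCont (grad v) x" if "norm x < 2" for x
    using v(2) that by (simp add: continuous_on_eq_continuous_at)
  note D\<phi> = C1_differentiable_on_real[OF C1_near_1(1) open_ball]
    and D\<xi> = C1_differentiable_on_real[OF C1_near_1(2) open_ball]
    and D\<psi> = C1_differentiable_on_real[OF C1_near_1(3) open_ball]
  have cont: "isCont \<phi> l" "isCont \<xi> l" "isCont \<psi> l"
    "isCont (deriv \<phi>) l" "isCont (deriv \<xi>) l" "isCont (deriv \<psi>) l" if "l \<in> ball 1 \<delta>" for l
    using that DERIV_isCont[OF D\<phi>(1)] DERIV_isCont[OF D\<xi>(1)] DERIV_isCont[OF D\<psi>(1)]
      D\<phi>(2) D\<xi>(2) D\<psi>(2) continuous_on_eq_continuous_at[OF open_ball, of "1::real" \<delta>] by blast+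
  have one: "1 \<in> ball (1::real) \<delta>" using \<delta> by simp
  define \<Phi> where "\<Phi> = Phi \<phi> \<xi> \<psi> v"
  have \<Phi>: "\<Phi> x l y = \<phi> l * v (x + \<xi> l *\<^sub>R y) + \<psi> l" for x l y by (simp add: \<Phi>_def Phi_def)
  have \<Phi>1: "\<Phi> 0 1 y = v y" for y by (simp add: \<Phi> at_1)
  \<comment> \<open>The derivative of \<open>\<Phi> 0 l y\<close> in \<open>l\<close>. At \<open>l = 1\<close>, \<open>y = 0\<close> it equals \<open>\<phi>' v 0 + \<psi>'\<close>, which is positive.\<close>
  define \<omega> where "\<omega> = (\<lambda>l y. deriv \<phi> l * v (\<xi> l *\<^sub>R y) + \<phi> l * deriv \<xi> l * (grad v (\<xi> l *\<^sub>R y) \<bullet> y) + deriv \<psi> l)"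

  obtain c where c: "c > 0" and near: "\<And>x l y. norm x < c \<Longrightarrow> \<bar>l - 1\<bar> < c \<Longrightarrow> norm y < c \<Longrightarrow>
      \<bar>l - 1\<bar> < \<delta> \<and> \<bar>l - 1\<bar> < \<epsilon> \<and> \<xi> l > 0 \<and> \<phi> l > 0 \<and> norm (x + \<xi> l *\<^sub>R y) < 2 \<and> \<Phi> x l y > 0 \<and>
      norm (y + (1 / \<xi> l) *\<^sub>R x) < \<epsilon> \<and> \<omega> l y > 0"
  proof -
    let ?F = "nhds (0::real^'n, 1::real, 0::real^'n)"
    let ?x = "\<lambda>p::(real^'n) \<times> real \<times> (real^'n). fst p" and ?l = "\<lambda>p::(real^'n) \<times> real \<times> (real^'n). fst (snd p)"
      and ?y = "\<lambda>p::(real^'n) \<times> real \<times> (real^'n). snd (snd p)"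
    have id: "((\<lambda>p. p) \<longlongrightarrow> (0::real^'n, 1::real, 0::real^'n)) ?F" by (rule filterlim_ident)
    have lim: "(?x \<longlongrightarrow> 0) ?F" "(?l \<longlongrightarrow> 1) ?F" "(?y \<longlongrightarrow> 0) ?F"
      using tendsto_fst[OF id] tendsto_fst[OF tendsto_snd[OF id]] tendsto_snd[OF tendsto_snd[OF id]] by simp_all
    note comp = isCont_tendsto_compose[OF _ lim(2)]
    have lims: "((\<lambda>p. \<phi> (?l p)) \<longlongrightarrow> 1) ?F" "((\<lambda>p. \<xi> (?l p)) \<longlongrightarrow> 1) ?F" "((\<lambda>p. \<psi> (?l p)) \<longlongrightarrow> 0) ?F"
      using comp[OF cont(1)[OF one]] comp[OF cont(2)[OF one]] comp[OF cont(3)[OF one]] by (simp_all add: at_1)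
    note dlims = comp[OF cont(4)[OF one]] comp[OF cont(5)[OF one]] comp[OF cont(6)[OF one]]
    have \<xi>y: "((\<lambda>p. \<xi> (?l p) *\<^sub>R ?y p) \<longlongrightarrow> 0) ?F" using tendsto_scaleR[OF lims(2) lim(3)] by simp
    have arg: "((\<lambda>p. ?x p + \<xi> (?l p) *\<^sub>R ?y p) \<longlongrightarrow> 0) ?F" using tendsto_add[OF lim(1) \<xi>y] by simp
    have shifted: "((\<lambda>p. ?y p + (1 / \<xi> (?l p)) *\<^sub>R ?x p) \<longlongrightarrow> 0) ?F"
      using tendsto_add[OF lim(3) tendsto_scaleR[OF tendsto_divide[OF tendsto_const[of 1] lims(2)] lim(1)]] by simp
    have \<Phi>t: "((\<lambda>p. \<Phi> (?x p) (?l p) (?y p)) \<longlongrightarrow> v 0) ?F"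
      using tendsto_add[OF tendsto_mult[OF lims(1) isCont_tendsto_compose[OF v_cont arg]] lims(3)]
      by (simp add: \<Phi>)
    have "((\<lambda>p. \<omega> (?l p) (?y p)) \<longlongrightarrow> deriv \<phi> 1 * v 0 + 1 * deriv \<xi> 1 * (grad v 0 \<bullet> 0) + deriv \<psi> 1) ?F"
      unfolding \<omega>_def
      by (intro tendsto_add tendsto_mult tendsto_inner dlims lims(1) lim(3)
          isCont_tendsto_compose[OF v_cont \<xi>y] isCont_tendsto_compose[OF gv_cont \<xi>y]) simp_all
    moreover have "deriv \<phi> 1 * v 0 + 1 * deriv \<xi> 1 * (grad v 0 \<bullet> 0) + deriv \<psi> 1 > 0"
    proof (cases "deriv \<phi> 1 = 0")
      case True then show ?thesis using \<phi>_\<psi>_pos[OF one] by simp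
    next
      case False
      then have "deriv \<phi> 1 * v 0 > 0" using \<phi>_mono[OF one] v0 by (intro mult_pos_pos) auto
      then show ?thesis using \<psi>_mono[OF one] by simp
    qed
    ultimately have \<omega>t: "\<forall>\<^sub>F p in ?F. \<omega> (?l p) (?y p) > 0" by (rule order_tendstoD(1))
    have "\<forall>\<^sub>F p in ?F. dist (?l p) 1 < \<delta> \<and> dist (?l p) 1 < \<epsilon> \<and> \<xi> (?l p) > 0 \<and> \<phi> (?l p) > 0 \<and>
        dist (?x p + \<xi> (?l p) *\<^sub>R ?y p) 0 < 2 \<and> \<Phi> (?x p) (?l p) (?y p) > 0 \<and>
        dist (?y p + (1 / \<xi> (?l p)) *\<^sub>R ?x p) 0 < \<epsilon> \<and> \<omega> (?l p) (?y p) > 0"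
      using tendstoD[OF lim(2) \<delta>] tendstoD[OF lim(2) \<epsilon>] order_tendstoD(1)[OF lims(2), of 0]
        order_tendstoD(1)[OF lims(1), of 0] tendstoD[OF arg, of 2] order_tendstoD(1)[OF \<Phi>t v0]
        tendstoD[OF shifted \<epsilon>] \<omega>t
      by (simp add: eventually_conj_iff)
    then obtain d where d: "d > 0" "\<And>p. dist p (0, 1, 0) < d \<Longrightarrow>
        dist (?l p) 1 < \<delta> \<and> dist (?l p) 1 < \<epsilon> \<and> \<xi> (?l p) > 0 \<and> \<phi> (?l p) > 0 \<and>
        dist (?x p + \<xi> (?l p) *\<^sub>R ?y p) 0 < 2 \<and> \<Phi> (?x p) (?l p) (?y p) > 0 \<and>
        dist (?y p + (1 / \<xi> (?l p)) *\<^sub>R ?x p) 0 < \<epsilon> \<and> \<omega> (?l p) (?y p) > 0"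
      unfolding eventually_nhds_metric by blast
    show ?thesis
    proof (rule that[of "d / 3"])
      fix x :: "real^'n" and l :: real and y :: "real^'n" assume "norm x < d / 3" "\<bar>l - 1\<bar> < d / 3" "norm y < d / 3"
      then have "dist (x, l, y) (0, 1, 0) < d"
        using norm_triple_le[of x "l - 1" y] by (simp add: dist_norm)
      from d(2)[OF this] show "\<bar>l - 1\<bar> < \<delta> \<and> \<bar>l - 1\<bar> < \<epsilon> \<and> \<xi> l > 0 \<and> \<phi> l > 0 \<and> norm (x + \<xi> l *\<^sub>R y) < 2 \<and>
          \<Phi> x l y > 0 \<and> norm (y + (1 / \<xi> l) *\<^sub>R x) < \<epsilon> \<and> \<omega> l y > 0"
        by (simp add: dist_real_def)
    qed (use d in simp)
  qed

  have \<Phi>_lim: "((\<lambda>q. \<Phi> (X q) (L q) (Y q)) \<longlongrightarrow> \<Phi> x l y) F"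
    if "(X \<longlongrightarrow> x) F" "(L \<longlongrightarrow> l) F" "(Y \<longlongrightarrow> y) F" "norm x < c" "\<bar>l - 1\<bar> < c" "norm y < c" for X L Y x l y and F :: "'z filter"
  proof -
    have l: "l \<in> ball 1 \<delta>" and xy: "norm (x + \<xi> l *\<^sub>R y) < 2"
      using near[OF that(4,5,6)] by (auto simp: dist_real_def)
    note \<xi>l = isCont_tendsto_compose[OF cont(2)[OF l] that(2)]
    show ?thesis unfolding \<Phi>
      by (intro tendsto_add tendsto_mult isCont_tendsto_compose[OF cont(1)[OF l] that(2)]
          isCont_tendsto_compose[OF cont(3)[OF l] that(2)]
          isCont_tendsto_compose[OF v_cont[OF xy] tendsto_add[OF that(1) tendsto_scaleR[OF \<xi>l that(3)]]])
  qed

  have \<Phi>_less: "\<Phi> 0 l y < \<Phi> 0 l' y" if ll: "l < l'" "\<bar>l - 1\<bar> < c" "\<bar>l' - 1\<bar> < c" and y: "norm y < c" for l l' y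
  proof (rule DERIV_pos_imp_increasing[OF ll(1)])
    fix k assume k: "l \<le> k" "k \<le> l'"
    then have kc: "\<bar>k - 1\<bar> < c" using ll by linarith
    have kb: "k \<in> ball 1 \<delta>" and ky: "\<xi> k *\<^sub>R y \<in> ball 0 2" and pos: "\<omega> k y > 0"
      using near[OF _ kc y, of 0] c by (auto simp: dist_real_def)
    have \<xi>y: "((\<lambda>k. \<xi> k *\<^sub>R y) has_derivative (\<lambda>h. (deriv \<xi> k * h) *\<^sub>R y)) (at k)"
      using D\<xi>(1)[OF kb] by (intro has_derivative_scaleR_left) (simp add: has_field_derivative_def)
    have "((\<lambda>k. v (\<xi> k *\<^sub>R y)) has_real_derivative (deriv \<xi> k * (grad v (\<xi> k *\<^sub>R y) \<bullet> y))) (at k)"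
      using has_derivative_compose[OF \<xi>y has_2jet_gradient[OF v(4)[OF ky]]]
      unfolding has_field_derivative_def by (rule has_derivative_eq_rhs) (simp add: fun_eq_iff)
    from DERIV_add[OF DERIV_mult[OF D\<phi>(1)[OF kb] this] D\<psi>(1)[OF kb]]
    have "((\<lambda>k. \<Phi> 0 k y) has_real_derivative \<omega> k y) (at k)"
      unfolding \<Phi> \<omega>_def by (simp add: algebra_simps)
    then show "\<exists>z. ((\<lambda>k. \<Phi> 0 k y) has_real_derivative z) (at k) \<and> z > 0" using pos by blast
  qed

  have value_less: "\<phi> l * v x + \<psi> l < \<phi> l' * v x + \<psi> l'"
    if ll: "l < l'" "l \<in> ball 1 \<delta>" "l' \<in> ball 1 \<delta>" and x: "norm x < 2" for l l' x
  proof (rule DERIV_pos_imp_increasing[OF ll(1), of "\<lambda>l. \<phi> l * v x + \<psi> l"])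
    fix k assume k: "l \<le> k" "k \<le> l'"
    then have kb: "k \<in> ball 1 \<delta>" using ll by (auto simp: dist_real_def)
    have "((\<lambda>l. \<phi> l * v x + \<psi> l) has_real_derivative (deriv \<phi> k * v x + deriv \<psi> k)) (at k)"
      by (rule derivative_eq_intros D\<phi>(1)[OF kb] D\<psi>(1)[OF kb] refl)+ simp
    moreover have "deriv \<phi> k * v x + deriv \<psi> k > 0"
    proof (cases "deriv \<phi> k = 0")
      case True then show ?thesis using \<phi>_\<psi>_pos[OF kb] by simp
    next
      case False
      then have "deriv \<phi> k * v x > 0" using \<phi>_mono[OF kb] v_pos[of x] x by (intro mult_pos_pos) auto
      then show ?thesis using \<psi>_mono[OF kb] by simp
    qed
    ultimately show "\<exists>z. ((\<lambda>l. \<phi> l * v x + \<psi> l) has_real_derivative z) (at k) \<and> z > 0" by blast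
  qed

  have gap: "\<exists>\<eta>>0. \<exists>d>0. \<forall>x. 0 < norm x \<and> norm x < d \<longrightarrow> u x - v x \<ge> \<eta>"
  proof (rule ccontr)
    assume no_gap: "\<not> ?thesis"
    define r where "r = min c 1 / 2"
    have r: "0 < r" "r < c" "r < 1" using c by (auto simp: r_def)
    define R where "R = min c 1"
    have R: "r < R" "R \<le> c" "R \<le> 1" using c by (auto simp: r_def R_def)
    have u_cont: "isCont u y" if "y \<noteq> 0" "norm y < 2" for y using has_2jet_isCont[OF u(4)] that by simp

    obtain s1 where s1: "s1 > 0" "\<And>q y. dist q (0, 1) < s1 \<Longrightarrow> y \<in> sphere 0 r \<Longrightarrow> \<Phi> (fst q) (snd q) y < u y"
    proof -
      have "\<exists>e>0. \<forall>q. dist q (0, 1) < e \<longrightarrow> (\<forall>y\<in>sphere 0 r. \<Phi> (fst q) (snd q) y < u y)"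
      proof (rule uniform_on_compact[OF compact_sphere])
        fix y :: "real^'n" assume y: "y \<in> sphere 0 r"
        let ?F = "nhds ((0::real^'n, 1::real), y)"
        have id: "((\<lambda>q. q) \<longlongrightarrow> ((0::real^'n, 1::real), y)) ?F" by (rule filterlim_ident)
        have lim: "((\<lambda>q. fst (fst q)) \<longlongrightarrow> 0) ?F" "((\<lambda>q. snd (fst q)) \<longlongrightarrow> 1) ?F" "(snd \<longlongrightarrow> y) ?F"
          using tendsto_fst[OF tendsto_fst[OF id]] tendsto_snd[OF tendsto_fst[OF id]] tendsto_snd[OF id] by simp_all
        have y': "y \<noteq> 0" "norm y < 2" "norm y < c" using y r by auto
        have "((\<lambda>q. u (snd q) - \<Phi> (fst (fst q)) (snd (fst q)) (snd q)) \<longlongrightarrow> u y - \<Phi> 0 1 y) ?F"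
          using c y' by (intro tendsto_diff \<Phi>_lim lim isCont_tendsto_compose[OF u_cont lim(3)]) auto
        moreover have "u y - \<Phi> 0 1 y > 0" using u_gt_v[of y] y' by (simp add: \<Phi>1)
        ultimately have "\<forall>\<^sub>F q in ?F. u (snd q) - \<Phi> (fst (fst q)) (snd (fst q)) (snd q) > 0"
          by (rule order_tendstoD(1))
        then show "\<forall>\<^sub>F q in ?F. snd q \<in> sphere 0 r \<longrightarrow> \<Phi> (fst (fst q)) (snd (fst q)) (snd q) < u (snd q)"
          by eventually_elim simp
      qed
      then show ?thesis using that by blast
    qed
    define \<sigma> where "\<sigma> = min s1 c / 3"
    have \<sigma>: "0 < \<sigma>" "\<sigma> < c" "3 * \<sigma> \<le> s1" using s1(1) c by (auto simp: \<sigma>_def)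
    have boundary: "\<Phi> x l y < u y" if "norm x \<le> \<sigma>" "\<bar>l - 1\<bar> \<le> \<sigma>" "norm y = r" for x l y
    proof -
      have "dist (x, l) (0, 1) \<le> norm x + \<bar>l - 1\<bar>"
        using norm_Pair_le[of x "l - 1"] by (simp add: dist_norm)
      then have "dist (x, l) (0, 1) < s1" using that(1,2) \<sigma> by linarith
      from s1(2)[OF this, of y] show ?thesis using that(3) by simp
    qed

    \<comment> \<open>The starting position: by monotonicity in the parameter \<open>\<Phi> 0 (1 - \<sigma>)\<close> lies strictly below
       \<open>\<Phi> 0 1 = v\<close> on the closed ball, and this persists for small translations \<open>x\<close>.\<close>
    obtain s2 where s2: "s2 > 0" "\<And>x y. dist x 0 < s2 \<Longrightarrow> y \<in> cball 0 r \<Longrightarrow> \<Phi> x (1 - \<sigma>) y < v y"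
    proof -
      have "\<exists>e>0. \<forall>x. dist x 0 < e \<longrightarrow> (\<forall>y\<in>cball 0 r. \<Phi> x (1 - \<sigma>) y < v y)"
      proof (rule uniform_on_compact[OF compact_cball])
        fix y :: "real^'n" assume y: "y \<in> cball 0 r"
        let ?F = "nhds (0::real^'n, y)"
        have id: "((\<lambda>q. q) \<longlongrightarrow> (0::real^'n, y)) ?F" by (rule filterlim_ident)
        have lim: "(fst \<longlongrightarrow> 0) ?F" "(snd \<longlongrightarrow> y) ?F"
          using tendsto_fst[OF id] tendsto_snd[OF id] by simp_all
        have y': "norm y < 2" "norm y < c" using y r by auto
        have "((\<lambda>q. v (snd q) - \<Phi> (fst q) (1 - \<sigma>) (snd q)) \<longlongrightarrow> v y - \<Phi> 0 (1 - \<sigma>) y) ?F"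
          using c y' \<sigma> by (intro tendsto_diff \<Phi>_lim lim tendsto_const isCont_tendsto_compose[OF v_cont lim(2)]) auto
        moreover have "v y - \<Phi> 0 (1 - \<sigma>) y > 0" using \<Phi>_less[of "1 - \<sigma>" 1 y] y' \<sigma> c by (simp add: \<Phi>1)
        ultimately have "\<forall>\<^sub>F q in ?F. v (snd q) - \<Phi> (fst q) (1 - \<sigma>) (snd q) > 0"
          by (rule order_tendstoD(1))
        then show "\<forall>\<^sub>F q in ?F. snd q \<in> cball 0 r \<longrightarrow> \<Phi> (fst q) (1 - \<sigma>) (snd q) < v (snd q)"
          by eventually_elim simp
      qed
      then show ?thesis using that by blast
    qed
    obtain s3 where s3: "s3 > 0" "\<And>x. dist x 0 < s3 \<Longrightarrow> \<Phi> x (1 + \<sigma>) 0 > v 0"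
    proof -
      have "((\<lambda>x. \<Phi> x (1 + \<sigma>) 0) \<longlongrightarrow> \<Phi> 0 (1 + \<sigma>) 0) (nhds 0)"
        using c \<sigma> by (intro \<Phi>_lim tendsto_const filterlim_ident) auto
      moreover have "\<Phi> 0 (1 + \<sigma>) 0 > v 0" using \<Phi>_less[of 1 "1 + \<sigma>" 0] \<sigma> c by (simp add: \<Phi>1)
      ultimately have "\<forall>\<^sub>F x in nhds 0. \<Phi> x (1 + \<sigma>) 0 > v 0" by (rule order_tendstoD(1))
      then show ?thesis using that unfolding eventually_nhds_metric by blast
    qed
    define \<rho> where "\<rho> = min (min s2 s3) (min \<sigma> 1)"
    have \<rho>: "\<rho> > 0" "\<rho> \<le> s2" "\<rho> \<le> s3" "\<rho> \<le> \<sigma>" "\<rho> \<le> 1" using s2 s3 \<sigma> by (auto simp: \<rho>_def)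

    \<comment> \<open>For each small \<open>x\<close> the parameter at which the value at the origin equals \<open>v 0\<close> is reached by sliding, and
       then the gradients at the origin agree.\<close>
    have contact: "\<exists>l. \<bar>l - 1\<bar> \<le> \<sigma> \<and> \<phi> l * v x + \<psi> l = v 0 \<and> (\<phi> l * \<xi> l) *\<^sub>R grad v x = grad v 0"
      if x: "norm x < \<rho>" for x
    proof -
      have xc: "norm x < c" "norm x < 2" "norm x \<le> \<sigma>" using x \<rho> \<sigma> by auto
      have \<sigma>\<delta>: "l \<in> ball 1 \<delta>" if "\<bar>l - 1\<bar> \<le> \<sigma>" for l
        using near[of 0 l 0] that \<sigma> c by (auto simp: dist_real_def)
      have "\<exists>l\<ge>1 - \<sigma>. l \<le> 1 + \<sigma> \<and> \<phi> l * v x + \<psi> l = v 0"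
      proof (rule IVT')
        show "\<phi> (1 - \<sigma>) * v x + \<psi> (1 - \<sigma>) \<le> v 0"
          using s2(2)[of x 0] x \<rho> r by (simp add: \<Phi>)
        show "v 0 \<le> \<phi> (1 + \<sigma>) * v x + \<psi> (1 + \<sigma>)"
          using s3(2)[of x] x \<rho> by (simp add: \<Phi>)
        show "continuous_on {1 - \<sigma>..1 + \<sigma>} (\<lambda>l. \<phi> l * v x + \<psi> l)"
          using \<sigma>\<delta> by (intro continuous_at_imp_continuous_on ballI isCont_add isCont_mult cont continuous_const)
            (auto simp: abs_le_iff)
      qed (use \<sigma> in simp)
      then obtain l where l: "1 - \<sigma> \<le> l" "l \<le> 1 + \<sigma>" "\<phi> l * v x + \<psi> l = v 0" by blast
      have range: "\<bar>k - 1\<bar> \<le> \<sigma>" "\<bar>k - 1\<bar> < c" if "k \<in> {1 - \<sigma>..l}" for k using that l \<sigma> by (auto simp: abs_le_iff)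
      define gW where "gW = (\<lambda>k y. (\<phi> k * \<xi> k) *\<^sub>R grad v (x + \<xi> k *\<^sub>R y))"
      define HW where "HW = (\<lambda>k y. (\<phi> k * (\<xi> k)\<^sup>2) *\<^sub>R hessian v (x + \<xi> k *\<^sub>R y))"
      have sub: "x + \<xi> k *\<^sub>R y \<in> ball 0 2" if "k \<in> {1 - \<sigma>..l}" "y \<in> ball 0 R" for k y
        using near[OF xc(1) range(2)[OF that(1)], of y] that(2) R by simp
      have jet: "has_2jet (\<Phi> x k) (gW k) (HW k y) y" if "k \<in> {1 - \<sigma>..l}" "y \<in> ball 0 R" for k y
        using has_2jet_comp_affine[OF v(4)[OF sub[OF that]], of "\<phi> k" "\<psi> k"]
        unfolding \<Phi>[abs_def] gW_def HW_def .
      have below: "\<Phi> x l y \<le> u y" if "y \<in> cball 0 r - {0}" for y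
      proof (rule sliding_method[where W = "\<Phi> x" and \<alpha> = "v 0" and gW = gW and HW = HW, OF DT n r(1) R(1) l(1)])
        have Ru: "ball 0 R - {0} \<subseteq> ball (0::real^'n) 2 - {0}" using R by auto
        show "has_2jet u (grad u) (hessian u y) y" if "y \<in> ball 0 R - {0}" for y using u(4) that Ru by blast
        show "continuous_on (ball 0 R - {0}) (grad u)" "continuous_on (ball 0 R - {0}) (hessian u)"
          using continuous_on_subset[OF _ Ru] u by blast+
        show "T (u y) (grad u y) (hessian u y) \<ge> 0" if "y \<in> ball 0 R - {0}" for y using T_u that Ru by blast
        fix k assume k: "k \<in> {1 - \<sigma>..l}"
        have aff: "continuous_on (ball 0 R) (\<lambda>y. x + \<xi> k *\<^sub>R y)" by (intro continuous_intros)
        have img: "(\<lambda>y. x + \<xi> k *\<^sub>R y) ` ball 0 R \<subseteq> ball 0 2" using sub[OF k] by blast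
        show "continuous_on (ball 0 R) (gW k)" unfolding gW_def
          by (intro continuous_on_scaleR continuous_on_const continuous_on_compose2[OF v(2) aff img])
        show "continuous_on (ball 0 R) (HW k)" unfolding HW_def
          by (intro continuous_on_scaleR continuous_on_const continuous_on_compose2[OF v(3) aff img])
        show "\<Phi> x k y < u y" if "norm y = r" for y by (rule boundary[OF xc(3) range(1)[OF k] that])
        fix y :: "real^'n" assume y: "y \<in> ball 0 R"
        then have yc: "norm y < c" using R by simp
        note nr = near[OF xc(1) range(2)[OF k] yc]
        show "has_2jet (\<Phi> x k) (gW k) (HW k y) y" by (rule jet[OF k y])
        show "\<Phi> x k y > 0" using nr by blast
        show "isCont (\<lambda>q. \<Phi> x (fst q) (snd q)) (k, y)"
        proof -
          have "((\<lambda>q. \<Phi> x (fst q) (snd q)) \<longlongrightarrow> \<Phi> x k y) (at (k, y))"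
          proof (rule \<Phi>_lim[OF tendsto_const _ _ xc(1) range(2)[OF k] yc])
            show "(fst \<longlongrightarrow> k) (at (k, y))" using tendsto_fst[OF tendsto_ident_at, of "(k, y)" UNIV] by simp
            show "(snd \<longlongrightarrow> y) (at (k, y))" using tendsto_snd[OF tendsto_ident_at, of "(k, y)" UNIV] by simp
          qed
          then show ?thesis by (simp add: isCont_def)
        qed
        show "T (\<Phi> x k y) (gW k y) (HW k y) \<le> 0"
        proof -
          \<comment> \<open>At \<open>y'\<close> the untranslated member of the family has the same jet as the translated one at \<open>y\<close>.\<close>
          define y' where "y' = y + (1 / \<xi> k) *\<^sub>R x"
          have eq: "0 + \<xi> k *\<^sub>R y' = x + \<xi> k *\<^sub>R y" using nr by (simp add: y'_def scaleR_add_right)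
          have "has_2jet v (grad v) (hessian v (x + \<xi> k *\<^sub>R y)) (0 + \<xi> k *\<^sub>R y')"
            unfolding eq by (rule v(4)[OF sub[OF k y]])
          from has_2jet_grad_hessian[OF has_2jet_comp_affine[OF this, of "\<phi> k" "\<psi> k"]]
          have "grad (Phi \<phi> \<xi> \<psi> v 0 k) y' = gW k y" "hessian (Phi \<phi> \<xi> \<psi> v 0 k) y' = HW k y"
            unfolding Phi_def[abs_def] gW_def HW_def eq by simp_all
          moreover have "Phi \<phi> \<xi> \<psi> v 0 k y' = \<Phi> x k y" unfolding Phi_def \<Phi> eq ..
          moreover have "y' \<in> ball 0 \<epsilon>" "\<bar>k - 1\<bar> < \<epsilon>" using nr by (simp_all add: y'_def)
          ultimately show ?thesis using T_Phi[of k y'] by simp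
        qed
      next
        show "\<Phi> x (1 - \<sigma>) y \<le> u y" if y: "y \<in> cball 0 r - {0}" for y
          using s2(2)[of x y] x \<rho> y u_gt_v[of y] r by auto
        show "\<Phi> x k 0 < v 0" if k: "k \<in> {1 - \<sigma>..<l}" for k
          using value_less[of k l x] \<sigma>\<delta>[of k] \<sigma>\<delta>[of l] xc l k by (auto simp: \<Phi> abs_le_iff)
        show "\<forall>\<^sub>F y in at 0. u y > \<beta>" if "\<beta> < v 0" for \<beta>
        proof -
          have "(v \<longlongrightarrow> v 0) (at 0)" using v_cont[of 0] by (simp add: isCont_def)
          from order_tendstoD(1)[OF this that] have "\<forall>\<^sub>F y in at 0. v y > \<beta>" .
          moreover have "\<forall>\<^sub>F y in at 0. u y > v y"
            unfolding eventually_at by (rule exI[of _ 2]) (auto intro!: u_gt_v)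
          ultimately show ?thesis by eventually_elim simp
        qed
      qed (rule that)
      have "(\<phi> l * \<xi> l) *\<^sub>R grad v x = grad v 0"
      proof (rule ccontr)
        assume ne: "\<not> ?thesis"
        have lI: "l \<in> {1 - \<sigma>..l}" using l by simp
        have J: "has_2jet (\<Phi> x l) (gW l) (HW l 0) 0" by (rule jet[OF lI]) (use r R in simp)
        have "\<exists>\<eta>>0. \<exists>\<rho>>0. \<forall>y. 0 < norm y \<and> norm y < \<rho> \<longrightarrow> u y \<ge> v 0 + \<eta>"
        proof (rule two_touching_minorants[OF n r(1), where w = "\<Phi> x l" and g = "grad u" and H = "hessian u"])
          have ru: "ball 0 r - {0} \<subseteq> ball (0::real^'n) 2 - {0}" using r by auto
          show "has_2jet u (grad u) (hessian u y) y" if "y \<in> ball 0 r - {0}" for y using u(4) that ru by blast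
          show "trace (hessian u y) \<le> 0" if "y \<in> ball 0 r - {0}" for y using tr_u that ru by blast
          show "v y \<le> u y" if "y \<in> ball 0 r - {0}" for y using u_gt_v[of y] that ru by force
          show "\<Phi> x l y \<le> u y" if "y \<in> ball 0 r - {0}" for y using below[of y] that by auto
          show "(v has_derivative (\<lambda>h. grad v 0 \<bullet> h)) (at 0)" by (rule has_2jet_gradient[OF v(4)]) simp
          show "(\<Phi> x l has_derivative (\<lambda>h. gW l 0 \<bullet> h)) (at 0)" by (rule has_2jet_gradient[OF J])
          show "v 0 = \<Phi> x l 0" using l(3) by (simp add: \<Phi>)
          show "grad v 0 \<noteq> gW l 0" using ne by (simp add: gW_def)
        qed
        then obtain \<eta> d where \<eta>: "\<eta> > 0" "d > 0" "\<And>y. 0 < norm y \<Longrightarrow> norm y < d \<Longrightarrow> u y \<ge> v 0 + \<eta>" by blast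
        obtain d' where d': "d' > 0" "\<And>y. norm y < d' \<Longrightarrow> \<bar>v y - v 0\<bar> < \<eta> / 2"
        proof -
          have "isCont v 0" using v_cont[of 0] by simp
          from tendstoD[OF isCont_tendsto_nhds[OF this] half_gt_zero[OF \<eta>(1)]]
          show ?thesis using that unfolding eventually_nhds_metric by (auto simp: dist_real_def)
        qed
        have "\<forall>y. 0 < norm y \<and> norm y < min d d' \<longrightarrow> u y - v y \<ge> \<eta> / 2"
          using \<eta>(3) d'(2) by (smt (verit) field_sum_of_halves)
        then show False using no_gap half_gt_zero[OF \<eta>(1)] \<eta>(2) d'(1) by (metis min_less_iff_conj)
      qed
      moreover have "\<bar>l - 1\<bar> \<le> \<sigma>" using l by linarith
      ultimately show ?thesis using l(3) by blast
    qed
    then obtain \<Lambda> where \<Lambda>: "\<And>x. norm x < \<rho> \<Longrightarrow> \<bar>\<Lambda> x - 1\<bar> \<le> \<sigma>"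
      "\<And>x. norm x < \<rho> \<Longrightarrow> \<phi> (\<Lambda> x) * v x + \<psi> (\<Lambda> x) = v 0"
      "\<And>x. norm x < \<rho> \<Longrightarrow> (\<phi> (\<Lambda> x) * \<xi> (\<Lambda> x)) *\<^sub>R grad v x = grad v 0"
      by metis
    \<comment> \<open>The gradient of \<open>v\<close> at \<open>x\<close> is the fixed vector \<open>grad v 0\<close> divided by \<open>\<mu> x\<close>, and \<open>\<mu>\<close> decreases as \<open>v\<close>
       increases.\<close>
    define \<mu> where "\<mu> = (\<lambda>x. \<phi> (\<Lambda> x) * \<xi> (\<Lambda> x))"
    have \<Lambda>near: "\<Lambda> x \<in> ball 1 \<delta>" "\<phi> (\<Lambda> x) > 0" "\<xi> (\<Lambda> x) > 0" if "norm x < \<rho>" for x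
      using near[of 0 "\<Lambda> x" 0] \<Lambda>(1)[OF that] \<sigma> c by (auto simp: dist_real_def)
    have \<mu>pos: "\<mu> x > 0" if "norm x < \<rho>" for x using \<Lambda>near[OF that] by (simp add: \<mu>_def)
    have grad_v: "grad v x = (1 / \<mu> x) *\<^sub>R grad v 0" if "norm x < \<rho>" for x
    proof -
      have "\<mu> x *\<^sub>R grad v x = grad v 0" using \<Lambda>(3)[OF that] by (simp add: \<mu>_def)
      then have "(1 / \<mu> x) *\<^sub>R grad v 0 = (1 / \<mu> x) *\<^sub>R (\<mu> x *\<^sub>R grad v x)" by simp
      also have "\<dots> = grad v x" using \<mu>pos[OF that] by simp
      finally show ?thesis by simp
    qed
    have \<mu>_anti: "\<mu> x' \<le> \<mu> x" if x: "norm x < \<rho>" "norm x' < \<rho>" and vv: "v x \<le> v x'" for x x'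
    proof -
      have "\<Lambda> x' \<le> \<Lambda> x"
      proof (rule ccontr)
        assume "\<not> ?thesis"
        then have "\<phi> (\<Lambda> x) * v x' + \<psi> (\<Lambda> x) < \<phi> (\<Lambda> x') * v x' + \<psi> (\<Lambda> x')"
          using \<Lambda>near x \<rho> by (intro value_less) auto
        moreover have "\<phi> (\<Lambda> x) * v x \<le> \<phi> (\<Lambda> x) * v x'" using vv \<Lambda>near(2)[OF x(1)] by (intro mult_left_mono) auto
        ultimately show False using \<Lambda>(2)[OF x(1)] \<Lambda>(2)[OF x(2)] by linarith
      qed
      then show ?thesis unfolding \<mu>_def
      proof (rule DERIV_nonneg_imp_nondecreasing)
        fix k assume "\<Lambda> x' \<le> k" "k \<le> \<Lambda> x"
        then have k: "k \<in> ball 1 \<delta>" using \<Lambda>near(1)[OF x(1)] \<Lambda>near(1)[OF x(2)] by (auto simp: dist_real_def)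
        have "((\<lambda>k. \<phi> k * \<xi> k) has_real_derivative (deriv \<phi> k * \<xi> k + \<phi> k * deriv \<xi> k)) (at k)"
          by (rule derivative_eq_intros D\<phi>(1)[OF k] D\<xi>(1)[OF k] refl)+ simp
        then show "\<exists>z. ((\<lambda>k. \<phi> k * \<xi> k) has_real_derivative z) (at k) \<and> 0 \<le> z" using \<phi>_\<xi>[OF k] by blast
      qed
    qed
    have mono: "(grad v x' - grad v x) \<bullet> (x' - x) \<ge> 0" if x: "norm x < \<rho>" "norm x' < \<rho>" for x x'
    proof -
      define D where "D = grad v 0 \<bullet> (x' - x)"
      have lhs: "(grad v x' - grad v x) \<bullet> (x' - x) = (1 / \<mu> x' - 1 / \<mu> x) * D"
        unfolding grad_v[OF x(1)] grad_v[OF x(2)] D_def by (simp add: inner_diff_left left_diff_distrib)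
      have seg: "norm (x + t *\<^sub>R (x' - x)) < \<rho>" if "0 \<le> t" "t \<le> 1" for t
      proof -
        have "x + t *\<^sub>R (x' - x) = (1 - t) *\<^sub>R x + t *\<^sub>R x'" by (simp add: algebra_simps)
        then show ?thesis
          using convexD[OF convex_ball, of x 0 \<rho> x' "1 - t" t] x that by simp
      qed
      \<comment> \<open>By the mean value theorem the increment of \<open>v\<close> has the sign of \<open>D\<close>, so the order of \<open>\<mu> x\<close> and
         \<open>\<mu> x'\<close> is known.\<close>
      have "\<exists>t. 0 < t \<and> t < 1 \<and> v (x + 1 *\<^sub>R (x' - x)) - v (x + 0 *\<^sub>R (x' - x))
          = (1 - 0) * (grad v (x + t *\<^sub>R (x' - x)) \<bullet> (x' - x))"
      proof (rule MVT2)
        fix t :: real assume t: "0 \<le> t" "t \<le> 1"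
        have L: "((\<lambda>t. x + t *\<^sub>R (x' - x)) has_derivative (\<lambda>h. h *\<^sub>R (x' - x))) (at t)"
          by (auto intro!: derivative_eq_intros)
        have "x + t *\<^sub>R (x' - x) \<in> ball 0 2" using seg[OF t] \<rho> by simp
        from has_derivative_compose[OF L has_2jet_gradient[OF v(4)[OF this]]]
        show "((\<lambda>t. v (x + t *\<^sub>R (x' - x))) has_real_derivative (grad v (x + t *\<^sub>R (x' - x)) \<bullet> (x' - x))) (at t)"
          unfolding has_field_derivative_def by (rule has_derivative_eq_rhs) (simp add: fun_eq_iff)
      qed simp
      then obtain t where t: "0 < t" "t < 1" "v x' - v x = grad v (x + t *\<^sub>R (x' - x)) \<bullet> (x' - x)" by auto
      define z where "z = x + t *\<^sub>R (x' - x)"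
      have z: "norm z < \<rho>" unfolding z_def using seg t by simp
      have vD: "v x' - v x = (1 / \<mu> z) * D"
        using t(3) grad_v[OF z] by (simp add: z_def[symmetric] D_def)
      show ?thesis
      proof (cases "D \<ge> 0")
        case True
        then have "(1 / \<mu> z) * D \<ge> 0" using \<mu>pos[OF z] by (intro mult_nonneg_nonneg) auto
        then have "v x' \<ge> v x" using vD by simp
        then have "1 / \<mu> x \<le> 1 / \<mu> x'" using \<mu>_anti[OF x] \<mu>pos[OF x(2)] by (intro frac_le) auto
        then show ?thesis unfolding lhs using True by simp
      next
        case False
        then have "(1 / \<mu> z) * D \<le> 0" using \<mu>pos[OF z] by (intro mult_nonneg_nonpos) auto
        then have "v x' \<le> v x" using vD by simp
        then have "1 / \<mu> x' \<le> 1 / \<mu> x" using \<mu>_anti[OF x(2,1)] \<mu>pos[OF x(1)] by (intro frac_le) auto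
        then show ?thesis unfolding lhs using False by (intro mult_nonpos_nonpos) auto
      qed
    qed
    have tr_v: "trace (hessian v x) \<ge> 0" if x: "norm x < \<rho>" for x
    proof (rule monotone_gradient_trace_nonneg[OF v(4)])
      show "x \<in> ball 0 2" using x \<rho> by simp
      show "\<forall>\<^sub>F y in nhds x. (grad v y - grad v x) \<bullet> (y - x) \<ge> 0"
        unfolding eventually_nhds using mono[OF x] x by (intro exI[of _ "ball 0 \<rho>"]) simp
    qed
    define s where "s = \<rho> / 2"
    have s: "0 < s" "s < \<rho>" "s < 2" using \<rho> by (auto simp: s_def)
    have s_sub: "cball 0 s - {0} \<subseteq> ball (0::real^'n) 2 - {0}" using s by auto
    have cont_uv: "continuous_on (cball 0 s - {0}) (\<lambda>x. u x - v x)"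
      using s_sub by (intro continuous_on_diff continuous_on_subset[OF u(1)] continuous_on_subset[OF v(1)]) auto
    have "sphere (0::real^'n) s \<noteq> {}" using s by simp
    moreover have "continuous_on (sphere 0 s) (\<lambda>x. u x - v x)"
      by (rule continuous_on_subset[OF cont_uv]) (use s in auto)
    ultimately have "\<exists>b\<in>sphere 0 s. \<forall>x\<in>sphere 0 s. u b - v b \<le> u x - v x"
      by (intro continuous_attains_inf compact_sphere)
    then obtain b where b: "b \<in> sphere 0 s" "\<And>x. x \<in> sphere 0 s \<Longrightarrow> u b - v b \<le> u x - v x"
      by blast
    have "u x - v x \<ge> u b - v b" if "x \<in> cball 0 s - {0}" for x
    proof (rule punctured_ball_minimum_principle[OF n cont_uv _ _ _ _ that])
      show "has_2jet (\<lambda>x. u x - v x) (\<lambda>x. grad u x - grad v x) (hessian u x - hessian v x) x"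
        if "x \<in> ball 0 s - {0}" for x using that s by (intro has_2jet_minus u(4) v(4)) auto
      show "trace (hessian u x - hessian v x) \<le> 0" if "x \<in> ball 0 s - {0}" for x
        using tr_u[of x] tr_v[of x] that s by (auto simp: trace_sub)
      show "u x - v x \<ge> 0" if "x \<in> cball 0 s - {0}" for x using u_gt_v[of x] that s by auto
      show "u x - v x \<ge> u b - v b" if "norm x = s" for x using b(2)[of x] that by simp
    qed
    moreover have "u b - v b > 0" using u_gt_v[of b] b(1) s by auto
    ultimately have "\<exists>\<eta>>0. \<exists>d>0. \<forall>x. 0 < norm x \<and> norm x < d \<longrightarrow> u x - v x \<ge> \<eta>"
      using s(1) by (intro exI[of _ "u b - v b"] exI[of _ s] conjI allI impI) auto
    then show False using no_gap by blast
  qed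
  then obtain \<eta> d where \<eta>: "\<eta> > 0" "d > 0" "\<And>x. 0 < norm x \<Longrightarrow> norm x < d \<Longrightarrow> u x - v x \<ge> \<eta>" by blast
  have "\<forall>\<^sub>F x in at 0. ereal \<eta> \<le> ereal (u x - v x)"
    unfolding eventually_at using \<eta>(2,3) by (intro exI[of _ d]) auto
  then have "ereal \<eta> \<le> Liminf (at 0) (\<lambda>x. ereal (u x - v x))" by (rule Liminf_bounded)
  moreover have "0 < ereal \<eta>" using \<eta>(1) by simp
  ultimately show ?thesis by (rule less_le_trans[rotated])
qed

end
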